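(* Let $n,m\ge2$ and let $\mathcal X_{n,m}$ be the set of weighted networks on a torus consisting of a family of $n$ horizontal wire cycles and a family of $m$ vertical wire cycles. Pick a $U_q'(\widehat{\mathfrak{sl}}_m)$- and a $U_q'(\widehat{\mathfrak{sl}}_n)$-crystal structure on $\mathcal X_{n,m}$ (i.e. choose one horizontal and one vertical cut of the torus), and let $e_i^c$ ($i\in\mathbb Z/n\mathbb Z$) and $\bar e_j^{\,d}$ ($j\in\mathbb Z/m\mathbb Z$) be the crystal operators of the $U_q'(\widehat{\mathfrak{sl}}_n)$- and $U_q'(\widehat{\mathfrak{sl}}_m)$-structures, and $s_i$, $\bar s_j$ the corresponding Weyl group generators. Then: (1) The finite ($U_q(\mathfrak{sl}_n)$ and $U_q(\mathfrak{sl}_m)$) crystal actions commute: $e_i^c\,\bar e_j^{\,d}=\bar e_j^{\,d}\,e_i^c$ for $1\le i\le n-1$, $1\le j\le m-1$. (2) The $U_q'(\widehat{\mathfrak{sl}}_m)$ (resp. $U_q'(\widehat{\mathfrak{sl}}_n)$) crystal action commutes with the Weyl group action for $U_q(\mathfrak{sl}_n)$ (resp. $U_q(\mathfrak{sl}_m)$), which acts as the $R$-matrix: $\bar e_j^{\,d}$ for all $j\in\mathbb Z/m\mathbb Z$ commutes with $s_i$ for $1\le i\le n-1$, and $e_i^c$ for all $i\in\mathbb Z/n\mathbb Z$ commutes with $\bar s_j$ for $1\le j\le m-1$. (3) The affine Weyl group actions of the $U_q'(\widehat{\mathfrak{sl}}_m)$- and $U_q'(\widehat{\mathfrak{sl}}_n)$-crystals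 commute: $s_i\bar s_j=\bar s_js_i$ for all $i\in\mathbb Z/n\mathbb Z$, $j\in\mathbb Z/m\mathbb Z$.
   Context: Networks are oriented, embedded in an oriented surface, with every vertex (crossing) having two adjacent incoming and two adjacent outgoing edges, and a weight. A wire goes straight through each crossing. On the oriented torus take $n$ disjoint "horizontal" wire cycles $W_1,\dots,W_n$, all oriented in the same direction, and $m$ disjoint "vertical" wire cycles $V_1,\dots,V_m$, all oriented in the same direction, the two homology classes forming a basis of $H_1$ of the torus; each $W_i$ crosses each $V_j$ exactly once, with weight $x_j^{(i)}\in\mathbb C^*$. The wires are cyclically numbered so that $W_{i+1}$ is the next horizontal cycle to the right of $W_i$, and $V_{j+1}$ is the next vertical cycle to the right of $V_j$. $\mathcal X_{n,m}$ is the set of networks obtained by varying the weights. Crystal structures. A vertical cut is a closed curve parallel to the vertical cycles lying between two adjacent ones; number so that it lies between $V_m$ and $V_1$. Cutting along it makes each $W_i$ a path on a cylinder; $(W_i,W_{i+1})$, $i\in\mathbb Z/n\mathbb Z$, are then pairs of parallel wires with $W_i$ to the left. The $U_q'(\widehat{\mathfrak{sl}}_n)$-crystal structure consists of the functions $\varepsilon_i=\varepsilon(W_i,W_{i+1})$, $\varphi_i=\varphi(W_i,W_{i+1})$ and the rational actions $e_i^c=e^c(\cdot,W_i,W_{i+1})$ defined below. Similarly a horizontal cut lies between $W_n$ and $W_1$ and gives the $U_q'(\widehat{\mathfrak{sl}}_m)$-crystal structure with $\bar e_j^{\,d}=e^d(\cdot,V_j,V_{j+1})$, $j\in\mathbb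 Z/m\mathbb Z$. The finite $U_q(\mathfrak{sl}_n)$ (resp. $U_q(\mathfrak{sl}_m)$) structure uses only $i=1,\dots,n-1$ (resp. $j=1,\dots,m-1$), so the affine node is the pair $(W_n,W_1)$ (resp. $(V_m,V_1)$). The Weyl group generators are $s_i=e_i^{\gamma_i^{-1}}$, $\gamma_i=\varphi_i/\varepsilon_i$, and similarly $\bar s_j$; $\bar s_j$ acts as the $R$-matrix on the two factors corresponding to $V_j,V_{j+1}$ when $\mathcal X_{n,m}$ is viewed as a $U_q'(\widehat{\mathfrak{sl}}_n)$-crystal which is a product of $m$ basic (or dual basic) affine geometric crystals, one for each vertical cycle, and similarly for $s_i$. Definition of $\varepsilon,\varphi,e^c$ for parallel wires $W,W'$ (same direction, $W$ immediately to the left of $W'$). Let the orthogonal wires crossing them be numbered $1,\dots,\ell$ along $W$ (starting at the cut), with weights $x^{(i)}$ on $W$ and $y^{(i)}$ on $W'$. Put $z^{(i)}=x^{(i)},t^{(i)}=y^{(i)}$ if the $i$-th orthogonal wire meets $W'$ first (crossing the strip from $W'$ to $W$), and $z^{(i)}=y^{(i)},t^{(i)}=x^{(i)}$ if it meets $W$ first. With $D=\sum_{s=0}^{\ell-1}t^{(1)}\cdots t^{(s)}z^{(s+2)}\cdots z^{(\ell)}$, set $\varphi(W,W')=\prod_i z^{(i)}/D$ and $\varepsilon(W,W')=\prod_i t^{(i)}/D$. For $c\in\mathbb C^*$, $e^c(\mathcal N,W,W')$ is obtained by adding a crossing $v$ of $W$ and $W'$ before all their vertices with weight $(c-1)\varphi(W,W')$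 and a crossing $u$ after all their vertices with weight $(c^{-1}-1)\varepsilon(W,W')$, moving $v$ past all orthogonal wires by Yang–Baxter moves, after which the weights of $v$ and $u$ are opposite and both are removed. Yang–Baxter move: for three wire segments pairwise crossing once and forming an empty triangle that is not an oriented cycle, with crossings ordered $v_1,v_2,v_3$ (edges $v_1\to v_2\to v_3$, $v_1\to v_3$) of weights $x,y,z$, slide one segment across the crossing of the other two; the new crossings, ordered likewise, have weights $\frac{yz}{x+z},x+z,\frac{xy}{x+z}$. All identities are identities of rational maps. *)

theory Defs
  imports Complex_Main "HOL-Library.FuncSet"
begin

section \<open>Pairs of parallel wires\<close>

text \<open>
  Rational maps are modelled by partial functions (type \<open>\<rightharpoonup>\<close>), undefined where a
  denominator occurring in the construction vanishes.

  A strip records two parallel wires \<open>W\<close>, \<open>W'\<close> (with \<open>W\<close> immediately to the left of \<open>W'\<close>)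
  on a cut cylinder.  There is one entry \<open>(a, x, y)\<close> for each orthogonal wire, listed
  along \<open>W\<close> starting at the cut: \<open>a\<close> is the side from which the orthogonal wire arrives
  (so for \<open>FromLeft\<close> it meets \<open>W\<close> first, and for \<open>FromRight\<close> it meets \<open>W'\<close> first), and \<open>x\<close>,
  \<open>y\<close> are the weights of its crossings with \<open>W\<close> and \<open>W'\<close>.
\<close>

datatype side = FromLeft | FromRight

type_synonym strip = "(side \<times> complex \<times> complex) list"

fun z_wt :: "side \<times> complex \<times> complex \<Rightarrow> complex" where
  "z_wt (FromLeft, x, y) = y"
| "z_wt (FromRight, x, y) = x"

fun t_wt :: "side \<times> complex \<times> complex \<Rightarrow> complex" where
  "t_wt (FromLeft, x, y) = x"
| "t_wt (FromRight, x, y) = y"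

text \<open>List positions start at 0, so the entry \<open>S ! r\<close> carries the weights \<open>z\<close>, \<open>t\<close> of the
  orthogonal wire number \<open>r + 1\<close>.\<close>

definition strip_D :: "strip \<Rightarrow> complex" where
  "strip_D S = (\<Sum>s<length S. (\<Prod>r<s. t_wt (S ! r)) * (\<Prod>r\<in>{s+1..<length S}. z_wt (S ! r)))"

definition strip_phi :: "strip \<Rightarrow> complex" where
  "strip_phi S = (\<Prod>r<length S. z_wt (S ! r)) / strip_D S"

definition strip_eps :: "strip \<Rightarrow> complex" where
  "strip_eps S = (\<Prod>r<length S. t_wt (S ! r)) / strip_D S"

text \<open>The Yang--Baxter move: weights of \<open>v\<^sub>1, v\<^sub>2, v\<^sub>3\<close> before and after, where the crossings
  of the triangle are ordered by \<open>v\<^sub>1 \<rightarrow> v\<^sub>2 \<rightarrow> v\<^sub>3\<close>, \<open>v\<^sub>1 \<rightarrow> v\<^sub>3\<close>.\<close>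

definition yang_baxter :: "complex \<times> complex \<times> complex \<rightharpoonup> complex \<times> complex \<times> complex" where
  "yang_baxter = (\<lambda>(x, y, z).
     if x + z = 0 then None else Some (y * z / (x + z), x + z, x * y / (x + z)))"

text \<open>
  Moving a crossing \<open>v\<close> (of weight \<open>w\<close>) of the two wires of a strip past one orthogonal wire
  \<open>O\<close>.  Let \<open>p\<close> and \<open>q\<close> be the crossings of \<open>O\<close> with the left and the right strand.  Before the
  move \<open>v\<close> precedes both; after it \<open>v\<close> follows both.  If \<open>O\<close> arrives from the left, the order
  is \<open>v \<rightarrow> p \<rightarrow> q\<close> before and \<open>p \<rightarrow> q \<rightarrow> v\<close> after; otherwise it is \<open>v \<rightarrow> q \<rightarrow> p\<close> before
  and \<open>q \<rightarrow> p \<rightarrow> v\<close> after.  The result is the new entry of the strip and the new weight of \<open>v\<close>.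
\<close>

fun slide_past :: "complex \<Rightarrow> side \<times> complex \<times> complex \<rightharpoonup> (side \<times> complex \<times> complex) \<times> complex"
  where
  "slide_past w (FromLeft, x, y) =
     map_option (\<lambda>(p, q, w'). ((FromLeft, p, q), w')) (yang_baxter (w, x, y))"
| "slide_past w (FromRight, x, y) =
     map_option (\<lambda>(q, p, w'). ((FromRight, p, q), w')) (yang_baxter (w, y, x))"

fun slide_through :: "complex \<Rightarrow> strip \<rightharpoonup> strip \<times> complex" where
  "slide_through w [] = Some ([], w)"
| "slide_through w (a # S) =
     (case slide_past w a of None \<Rightarrow> None
      | Some (a', w') \<Rightarrow> map_option (\<lambda>(S', w''). (a' # S', w'')) (slide_through w' S))"

text \<open>
  The action \<open>e\<^sup>c\<close>: \<open>v\<close> enters before all crossings with weight \<open>(c - 1) \<phi>\<close> and is moved through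
  the strip; it then is next to \<open>u\<close>, which has weight \<open>(1/c - 1) \<epsilon>\<close>, and the two are removed
  if their weights are opposite.
\<close>

definition strip_action :: "complex \<Rightarrow> strip \<rightharpoonup> strip" where
  "strip_action c S =
     (if c = 0 \<or> strip_D S = 0 then None
      else case slide_through ((c - 1) * strip_phi S) S of None \<Rightarrow> None
      | Some (S', w) \<Rightarrow> if w + (inverse c - 1) * strip_eps S = 0 then Some S' else None)"

section \<open>Networks on the torus\<close>

text \<open>
  A network is given by its weights: the value at \<open>(i, j)\<close> is the weight \<open>x\<^sub>j\<^sup>(\<^sup>i\<^sup>)\<close> of the
  crossing of \<open>W\<^sub>i\<close> and \<open>V\<^sub>j\<close>.  Residues modulo \<open>k\<close> are represented by \<open>1, \<dots>, k\<close>.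

  As the two homology classes form a basis, the vertical wires cross the horizontal ones
  either all from left to right or all from right to left.  The parameter \<open>a\<close> below is the side
  of the \<open>W\<^sub>i\<close> from which the \<open>V\<^sub>j\<close> arrive; at each crossing, \<open>W\<^sub>i\<close> then arrives
  from the opposite side of \<open>V\<^sub>j\<close>.
\<close>

type_synonym network = "nat \<times> nat \<Rightarrow> complex"

definition torus_networks :: "nat \<Rightarrow> nat \<Rightarrow> network set" where
  "torus_networks n m = {1..n} \<times> {1..m} \<rightarrow>\<^sub>E - {0}"

fun opposite :: "side \<Rightarrow> side" where
  "opposite FromLeft = FromRight"
| "opposite FromRight = FromLeft"

definition cyc_succ :: "nat \<Rightarrow> nat \<Rightarrow> nat" where
  "cyc_succ k i = (if i = k then 1 else i + 1)"

text \<open>Each wire of a family of \<open>k\<close> parallel wires has its successor to its right, and the cut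
  is between number \<open>k\<close> and number \<open>1\<close>.  An orthogonal wire that starts at the cut and arrives
  from side \<open>a\<close> meets them in the following order.\<close>

fun meeting_order :: "side \<Rightarrow> nat \<Rightarrow> nat list" where
  "meeting_order FromLeft k = [1..<Suc k]"
| "meeting_order FromRight k = rev [1..<Suc k]"

text \<open>The crossings on \<open>(W\<^sub>i, W\<^sub>i\<^sub>+\<^sub>1)\<close> in the order along \<open>W\<^sub>i\<close> from the vertical cut, and those
  on \<open>(V\<^sub>j, V\<^sub>j\<^sub>+\<^sub>1)\<close> in the order along \<open>V\<^sub>j\<close> from the horizontal cut.\<close>

definition hor_pairs :: "side \<Rightarrow> nat \<Rightarrow> nat \<Rightarrow> nat \<Rightarrow> ((nat \<times> nat) \<times> (nat \<times> nat)) list" where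
  "hor_pairs a n m i = map (\<lambda>j. ((i, j), (cyc_succ n i, j))) (meeting_order (opposite a) m)"

definition vert_pairs :: "side \<Rightarrow> nat \<Rightarrow> nat \<Rightarrow> nat \<Rightarrow> ((nat \<times> nat) \<times> (nat \<times> nat)) list" where
  "vert_pairs a n m j = map (\<lambda>i. ((i, j), (i, cyc_succ m j))) (meeting_order a n)"

definition get_strip :: "side \<Rightarrow> ((nat \<times> nat) \<times> (nat \<times> nat)) list \<Rightarrow> network \<Rightarrow> strip" where
  "get_strip a ps N = map (\<lambda>(p, q). (a, N p, N q)) ps"

definition put_strip :: "((nat \<times> nat) \<times> (nat \<times> nat)) list \<Rightarrow> network \<Rightarrow> strip \<Rightarrow> network" where
  "put_strip ps N S = fold (\<lambda>((p, q), (_, x, y)) N'. N'(p := x, q := y)) (zip ps S) N"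

text \<open>The \<open>U\<^sub>q'(sl\<^sub>n^)\<close>-structure (prefix \<open>hor\<close>, on the pairs of horizontal wires) and the
  \<open>U\<^sub>q'(sl\<^sub>m^)\<close>-structure (prefix \<open>vert\<close>).\<close>

definition hor_strip :: "side \<Rightarrow> nat \<Rightarrow> nat \<Rightarrow> nat \<Rightarrow> network \<Rightarrow> strip" where
  "hor_strip a n m i N = get_strip a (hor_pairs a n m i) N"

definition vert_strip :: "side \<Rightarrow> nat \<Rightarrow> nat \<Rightarrow> nat \<Rightarrow> network \<Rightarrow> strip" where
  "vert_strip a n m j N = get_strip (opposite a) (vert_pairs a n m j) N"

definition hor_e :: "side \<Rightarrow> nat \<Rightarrow> nat \<Rightarrow> nat \<Rightarrow> complex \<Rightarrow> network \<rightharpoonup> network" where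
  "hor_e a n m i c N =
     map_option (put_strip (hor_pairs a n m i) N) (strip_action c (hor_strip a n m i N))"

definition vert_e :: "side \<Rightarrow> nat \<Rightarrow> nat \<Rightarrow> nat \<Rightarrow> complex \<Rightarrow> network \<rightharpoonup> network" where
  "vert_e a n m j d N =
     map_option (put_strip (vert_pairs a n m j) N) (strip_action d (vert_strip a n m j N))"

definition hor_gamma :: "side \<Rightarrow> nat \<Rightarrow> nat \<Rightarrow> nat \<Rightarrow> network \<Rightarrow> complex" where
  "hor_gamma a n m i N = strip_phi (hor_strip a n m i N) / strip_eps (hor_strip a n m i N)"

definition vert_gamma :: "side \<Rightarrow> nat \<Rightarrow> nat \<Rightarrow> nat \<Rightarrow> network \<Rightarrow> complex" where
  "vert_gamma a n m j N = strip_phi (vert_strip a n m j N) / strip_eps (vert_strip a n m j N)"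

definition hor_s :: "side \<Rightarrow> nat \<Rightarrow> nat \<Rightarrow> nat \<Rightarrow> network \<rightharpoonup> network" where
  "hor_s a n m i N = hor_e a n m i (inverse (hor_gamma a n m i N)) N"

definition vert_s :: "side \<Rightarrow> nat \<Rightarrow> nat \<Rightarrow> nat \<Rightarrow> network \<rightharpoonup> network" where
  "vert_s a n m j N = vert_e a n m j (inverse (vert_gamma a n m j N)) N"

section \<open>Equality of rational maps\<close>

inductive_set poly_functions :: "'a set \<Rightarrow> (('a \<Rightarrow> complex) \<Rightarrow> complex) set" for A :: "'a set" where
  const: "(\<lambda>_. k) \<in> poly_functions A"
| coord: "a \<in> A \<Longrightarrow> (\<lambda>x. x a) \<in> poly_functions A"
| add: "f \<in> poly_functions A \<Longrightarrow> g \<in> poly_functions A \<Longrightarrow> (\<lambda>x. f x + g x) \<in> poly_functions A"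
| mult: "f \<in> poly_functions A \<Longrightarrow> g \<in> poly_functions A \<Longrightarrow> (\<lambda>x. f x * g x) \<in> poly_functions A"

text \<open>Two rational self-maps are equal if they are both defined and agree on a nonempty
  (equivalently, dense) Zariski open subset.\<close>

definition rational_map_eq ::
    "nat \<Rightarrow> nat \<Rightarrow> (network \<rightharpoonup> network) \<Rightarrow> (network \<rightharpoonup> network) \<Rightarrow> bool" where
  "rational_map_eq n m F G \<longleftrightarrow>
     (\<exists>p \<in> poly_functions ({1..n} \<times> {1..m}).
        (\<exists>N \<in> torus_networks n m. p N \<noteq> 0) \<and>
        (\<forall>N \<in> torus_networks n m. p N \<noteq> 0 \<longrightarrow>
           (\<exists>N' \<in> torus_networks n m. F N = Some N' \<and> G N = Some N')))"

definition rationally_commute ::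
    "nat \<Rightarrow> nat \<Rightarrow> (network \<rightharpoonup> network) \<Rightarrow> (network \<rightharpoonup> network) \<Rightarrow> bool" where
  "rationally_commute n m F G \<longleftrightarrow> rational_map_eq n m (F \<circ>\<^sub>m G) (G \<circ>\<^sub>m F)"

end

theory Submission
  imports Defs "HOL-Computational_Algebra.Polynomial"
begin

text \<open>
  Number the horizontal wires in the order in which the vertical ones meet them after the cut,
  and the vertical wires in the order in which the horizontal ones meet them. The network
  becomes an \<open>n \<times> m\<close> grid of weights, and on both sides of the torus a pair of parallel wires
  consists of two consecutive lines \<open>k\<close>, \<open>k + 1\<close> of the grid, with the weights \<open>t\<close> on line \<open>k\<close>
  and \<open>z\<close> on line \<open>k + 1\<close>. The two crystal structures are exchanged by transposing the grid.

  Solving the recursion of the Yang--Baxter moves gives the operators in closed form: if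
  \<open>E\<^sub>r = c (\<Sum>s<r. \<pi>\<^sub>s) + b (\<Sum>s\<ge>r. \<pi>\<^sub>s)\<close>, where \<open>\<pi>\<^sub>s\<close> are the summands of \<open>D\<close>, the operator with
  parameter \<open>c / b\<close> replaces \<open>t\<^sub>r\<close> by \<open>t\<^sub>r E\<^sub>r / E\<^sub>r\<^sub>+\<^sub>1\<close> and \<open>z\<^sub>r\<close> by \<open>z\<^sub>r E\<^sub>r\<^sub>+\<^sub>1 / E\<^sub>r\<close>
  (\<open>strip_action_closed_form\<close>). The Weyl group generators are the case
  \<open>b = \<Prod>z\<close>, \<open>c = \<Prod>t\<close>.

  Let a row operator act on rows \<open>k\<close>, \<open>k + 1\<close> and a column operator on columns \<open>l\<close>, \<open>l + 1\<close>. On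
  the rows the column operator keeps the products of the weights in columns \<open>l\<close>, \<open>l + 1\<close> and the
  sum \<open>t\<^sub>l + z\<^sub>l\<^sub>+\<^sub>1\<close>. All row denominators except \<open>E\<^sub>l\<^sub>+\<^sub>1\<close> are functions of these, so they do
  not change. The new \<open>E\<^sub>l\<^sub>+\<^sub>1\<close> times the old column denominator number \<open>k + 1\<close> is a polynomial
  that is symmetric under transposition (\<open>grid_denom_after_column_op\<close>), so it is also the new
  column denominator times the old \<open>E\<^sub>l\<^sub>+\<^sub>1\<close>. Hence both composites multiply every weight by the
  same factor (\<open>row_op_column_op_commute_at\<close>).

  This settles the pairs of lines that are not separated by a cut. A Weyl group generator is
  invariant under moving the cut that crosses its two wires (\<open>realizes_Weyl_rotate\<close>), so when
  one of the two operators is such a generator, the grid can be rotated until the lines of the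
  other operator are consecutive.

  Finally, the composites have to be defined on a dense open set. The vanishing of finitely many
  polynomials is avoided at a common point as soon as each of them is nonzero somewhere
  (\<open>common_nonzero_torus_network\<close>), and suitable points are found by setting lines of the grid
  to \<open>0\<close> or \<open>1\<close> and by interpolating between such points.
\<close>

section \<open>Nonvanishing of polynomial functions\<close>

lemma poly_functions_sum:
  "(\<And>i. i \<in> I \<Longrightarrow> f i \<in> poly_functions A) \<Longrightarrow> (\<lambda>x. \<Sum>i\<in>I. f i x) \<in> poly_functions A"
proof (induction I rule: infinite_finite_induct)
  case (insert i I)
  have "f i \<in> poly_functions A" "(\<lambda>x. \<Sum>i\<in>I. f i x) \<in> poly_functions A"
    using insert by auto
  from poly_functions.add[OF this] show ?case using insert by simp
qed (auto intro: poly_functions.const)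

lemma poly_functions_prod:
  "(\<And>i. i \<in> I \<Longrightarrow> f i \<in> poly_functions A) \<Longrightarrow> (\<lambda>x. \<Prod>i\<in>I. f i x) \<in> poly_functions A"
proof (induction I rule: infinite_finite_induct)
  case (insert i I)
  have "f i \<in> poly_functions A" "(\<lambda>x. \<Prod>i\<in>I. f i x) \<in> poly_functions A"
    using insert by auto
  from poly_functions.mult[OF this] show ?case using insert by simp
qed (auto intro: poly_functions.const)

lemma poly_functions_diff:
  assumes "f \<in> poly_functions A" "g \<in> poly_functions A"
  shows "(\<lambda>x. f x - g x) \<in> poly_functions A"
  using poly_functions.add[OF assms(1) poly_functions.mult[OF poly_functions.const[of "-1"] assms(2)]]
  by simp

lemma poly_functions_restrict:
  assumes "f \<in> poly_functions A"
  shows "f (restrict x A) = f x"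
  using assms by induction auto

lemma poly_functions_on_line:
  assumes "f \<in> poly_functions A"
  shows "\<exists>q. \<forall>\<tau>. f (\<lambda>a. x a + \<tau> * y a) = poly q \<tau>"
  using assms
proof induction
  case (const k)
  show ?case by (rule exI[of _ "[:k:]"]) simp
next
  case (coord a)
  show ?case by (rule exI[of _ "[:x a, y a:]"]) simp
next
  case (add f g)
  then show ?case by (metis poly_add)
next
  case (mult f g)
  then show ?case by (metis poly_mult)
qed

text \<open>On the line through two points a polynomial function is a polynomial in one variable;
  if it does not vanish at one of the points, it has finitely many zeros on the line.\<close>

lemma common_nonzero_on_line:
  assumes "finite \<F>" "\<F> \<subseteq> poly_functions A" "\<And>f. f \<in> \<F> \<Longrightarrow> f x \<noteq> 0 \<or> f y \<noteq> 0"
  shows "\<exists>\<tau>. \<forall>f\<in>\<F>. f (\<lambda>a. x a + \<tau> * (y a - x a)) \<noteq> 0"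
proof -
  have "\<forall>f\<in>\<F>. \<exists>q. \<forall>\<tau>. f (\<lambda>a. x a + \<tau> * (y a - x a)) = poly q \<tau>"
    using assms(2) poly_functions_on_line[of _ A x "\<lambda>a. y a - x a"] by blast
  then obtain q where q: "\<And>f \<tau>. f \<in> \<F> \<Longrightarrow> f (\<lambda>a. x a + \<tau> * (y a - x a)) = poly (q f) \<tau>"
    by metis
  have "q f \<noteq> 0" if "f \<in> \<F>" for f
    using q[OF that, of 0] q[OF that, of 1] assms(3)[OF that] by auto
  then have "prod q \<F> \<noteq> 0" using assms(1) by simp
  then have "finite {\<tau>. poly (prod q \<F>) \<tau> = 0}" by (rule poly_roots_finite)
  then obtain \<tau> where "poly (prod q \<F>) \<tau> \<noteq> 0"
    by (metis (mono_tags, lifting) ex_new_if_finite infinite_UNIV_char_0 mem_Collect_eq)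
  then show ?thesis using assms(1) q by (auto simp: poly_prod)
qed

text \<open>The points at which the given functions do not vanish are arbitrary points of affine space,
  where weights may be zero: the coordinates are included among the functions. A common point for
  one more function is found on the line from the previous common point to a point at which the
  new function does not vanish.\<close>

lemma common_nonzero_torus_network:
  fixes n m :: nat
  defines "A \<equiv> {1..n} \<times> {1..m}"
  assumes "finite \<F>" "\<F> \<subseteq> poly_functions A" "\<And>f. f \<in> \<F> \<Longrightarrow> \<exists>x. f x \<noteq> 0"
  shows "\<exists>N \<in> torus_networks n m. \<forall>f\<in>\<F>. f N \<noteq> 0"
proof -
  define C where "C = (\<lambda>a (x :: network). x a) ` A"
  have C: "finite C" "C \<subseteq> poly_functions A"
    unfolding C_def A_def by (auto intro: poly_functions.coord)
  have "\<exists>x. \<forall>f \<in> \<F> \<union> C. f x \<noteq> 0"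
    using assms(2-4)
  proof (induction \<F> rule: finite_induct)
    case empty
    show ?case by (rule exI[of _ "\<lambda>_. 1"]) (auto simp: C_def)
  next
    case (insert f \<F>)
    then obtain x where x: "\<forall>f \<in> \<F> \<union> C. f x \<noteq> 0" by (metis insert_iff subset_insertI subset_trans)
    obtain y where y: "f y \<noteq> 0" using insert.prems by blast
    have "\<exists>\<tau>. \<forall>f\<in>insert f (\<F> \<union> C). f (\<lambda>a. x a + \<tau> * (y a - x a)) \<noteq> 0"
      by (rule common_nonzero_on_line[of _ A]) (use C insert x y in auto)
    then show ?case by auto
  qed
  then obtain x where x: "\<forall>f \<in> \<F> \<union> C. f x \<noteq> 0" by blast
  have "restrict x A \<in> torus_networks n m"
    using x unfolding torus_networks_def C_def A_def by auto
  moreover have "\<forall>f\<in>\<F>. f (restrict x A) \<noteq> 0"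
    using x assms(3) poly_functions_restrict by (metis UnCI subsetD)
  ultimately show ?thesis by blast
qed

section \<open>The crystal operators in closed form\<close>

text \<open>The summands of \<open>D\<close>, and the partial sums that occur while the crossing is moved through the
  strip.\<close>

definition path_term :: "(nat \<Rightarrow> complex) \<Rightarrow> (nat \<Rightarrow> complex) \<Rightarrow> nat \<Rightarrow> nat \<Rightarrow> complex" where
  "path_term t z L s = (\<Prod>r<s. t r) * (\<Prod>r\<in>{Suc s..<L}. z r)"

definition partial_D :: "(nat \<Rightarrow> complex) \<Rightarrow> (nat \<Rightarrow> complex) \<Rightarrow> nat \<Rightarrow> nat \<Rightarrow> complex" where
  "partial_D t z L r = (\<Sum>s<r. path_term t z L s)"

text \<open>The operators \<open>e\<^sup>c\<close> and \<open>s\<close> are treated together. The parameter of the action is the quotient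
  of \<open>t_coef\<close> by \<open>z_coef\<close>, which for \<open>Weyl\<close> is \<open>\<epsilon> / \<phi>\<close>; with numerator and denominator kept
  apart, the denominators below are polynomials in the weights in both cases.\<close>

datatype crystal_op = Act complex | Weyl

fun t_coef :: "crystal_op \<Rightarrow> (nat \<Rightarrow> complex) \<Rightarrow> nat \<Rightarrow> complex" where
  "t_coef (Act c) t L = c"
| "t_coef Weyl t L = (\<Prod>r<L. t r)"

fun z_coef :: "crystal_op \<Rightarrow> (nat \<Rightarrow> complex) \<Rightarrow> nat \<Rightarrow> complex" where
  "z_coef (Act c) z L = 1"
| "z_coef Weyl z L = (\<Prod>r<L. z r)"

text \<open>The value is \<open>D\<close> times \<open>z_coef\<close> for \<open>r = 0\<close> and \<open>D\<close> times \<open>t_coef\<close> for \<open>r = L\<close>; in between,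
  one coefficient is exchanged for the other term by term.\<close>

definition denom :: "crystal_op \<Rightarrow> (nat \<Rightarrow> complex) \<Rightarrow> (nat \<Rightarrow> complex) \<Rightarrow> nat \<Rightarrow> nat \<Rightarrow> complex" where
  "denom \<theta> t z L r =
     t_coef \<theta> t L * partial_D t z L r + z_coef \<theta> z L * (partial_D t z L L - partial_D t z L r)"

abbreviation coef_diff :: "crystal_op \<Rightarrow> (nat \<Rightarrow> complex) \<Rightarrow> (nat \<Rightarrow> complex) \<Rightarrow> nat \<Rightarrow> complex" where
  "coef_diff \<theta> t z L \<equiv> t_coef \<theta> t L - z_coef \<theta> z L"

lemma partial_D_Suc: "partial_D t z L (Suc r) = partial_D t z L r + path_term t z L r"
  by (simp add: partial_D_def)

lemma denom_Suc: "denom \<theta> t z L (Suc r) = denom \<theta> t z L r + coef_diff \<theta> t z L * path_term t z L r"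
  by (simp add: denom_def partial_D_Suc algebra_simps)

lemma denom_0: "denom \<theta> t z L 0 = z_coef \<theta> z L * partial_D t z L L"
  by (simp add: denom_def partial_D_def)

lemma denom_end: "denom \<theta> t z L L = t_coef \<theta> t L * partial_D t z L L"
  by (simp add: denom_def)

lemma path_term_mult_z:
  assumes "r < L"
  shows "path_term t z L r * z r = (\<Prod>s<r. t s) * (\<Prod>s\<in>{r..<L}. z s)"
  using assms by (simp add: path_term_def prod.atLeast_Suc_lessThan)

text \<open>In terms of the weights \<open>t\<close> and \<open>z\<close> the Yang--Baxter move looks the same for both sides.\<close>

fun entry :: "side \<Rightarrow> complex \<Rightarrow> complex \<Rightarrow> side \<times> complex \<times> complex" where
  "entry FromLeft t z = (FromLeft, t, z)"
| "entry FromRight t z = (FromRight, z, t)"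

lemma entry_wts [simp]: "t_wt (entry a t z) = t" "z_wt (entry a t z) = z"
  by (cases a; simp)+

lemma slide_past_entry:
  "slide_past w (entry a t z) =
     (if w + z = 0 then None else Some (entry a (t * z / (w + z)) (w + z), w * t / (w + z)))"
  by (cases a) (auto simp: yang_baxter_def)

text \<open>The reciprocal of the weight \<open>w\<close> of the moving crossing satisfies the linear recursion
  \<open>1 / w\<^sub>r\<^sub>+\<^sub>1 = (1 + z\<^sub>r / w\<^sub>r) / t\<^sub>r\<close>. Its solution has the partial sums of \<open>D\<close> as coefficients;
  this is where the formula for \<open>w\<close> comes from.\<close>

lemma slide_through_closed_form:
  fixes \<theta> :: crystal_op and t z :: "nat \<Rightarrow> complex" and L :: nat
  defines "e \<equiv> denom \<theta> t z L"
  defines "w \<equiv> \<lambda>r. coef_diff \<theta> t z L * (\<Prod>s<r. t s) * (\<Prod>s\<in>{r..<L}. z s) / e r"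
  assumes e: "\<And>r. r \<le> L \<Longrightarrow> e r \<noteq> 0" and z: "\<And>r. r < L \<Longrightarrow> z r \<noteq> 0" and "r \<le> L"
  shows "slide_through (w r) (map (\<lambda>r. entry a (t r) (z r)) [r..<L]) =
           Some (map (\<lambda>r. entry a (t r * e r / e (Suc r)) (z r * e (Suc r) / e r)) [r..<L], w L)"
  using \<open>r \<le> L\<close>
proof (induction r rule: inc_induct)
  case base
  show ?case by simp
next
  case (step r)
  have er: "e r \<noteq> 0" "e (Suc r) \<noteq> 0" "z r \<noteq> 0" using e z step.hyps by auto
  have "e (Suc r) * z r = e r * z r + coef_diff \<theta> t z L * (path_term t z L r * z r)"
    by (simp add: e_def denom_Suc algebra_simps)
  then have "e (Suc r) * z r = e r * z r
      + coef_diff \<theta> t z L * (\<Prod>s<r. t s) * (\<Prod>s\<in>{r..<L}. z s)"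
    unfolding path_term_mult_z[OF step.hyps(2)] by (simp add: mult.assoc)
  then have sum: "w r + z r = z r * e (Suc r) / e r"
    using er by (simp add: w_def field_simps)
  have "w r * t r / (w r + z r) = w (Suc r)"
    unfolding sum using er step.hyps
    by (simp add: w_def prod.atLeast_Suc_lessThan field_simps)
  moreover have "t r * z r / (w r + z r) = t r * e r / e (Suc r)" "w r + z r \<noteq> 0"
    unfolding sum using er by (simp_all add: field_simps)
  ultimately have "slide_past (w r) (entry a (t r) (z r)) =
      Some (entry a (t r * e r / e (Suc r)) (z r * e (Suc r) / e r), w (Suc r))"
    by (simp add: slide_past_entry sum)
  then show ?case using step.IH step.hyps by (simp add: upt_conv_Cons)
qed

lemma strip_closed_forms:
  assumes "S = map (\<lambda>r. entry a (t r) (z r)) [0..<L]"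
  shows "strip_D S = partial_D t z L L"
    and "strip_phi S = (\<Prod>r<L. z r) / partial_D t z L L"
    and "strip_eps S = (\<Prod>r<L. t r) / partial_D t z L L"
proof -
  show D: "strip_D S = partial_D t z L L"
    unfolding assms strip_D_def partial_D_def path_term_def
    by (intro sum.cong arg_cong2[where f = "(*)"] prod.cong) auto
  show "strip_phi S = (\<Prod>r<L. z r) / partial_D t z L L"
    unfolding strip_phi_def D by (simp add: assms)
  show "strip_eps S = (\<Prod>r<L. t r) / partial_D t z L L"
    unfolding strip_eps_def D by (simp add: assms)
qed

lemma strip_action_closed_form:
  fixes \<theta> :: crystal_op and t z :: "nat \<Rightarrow> complex" and L :: nat
  defines "e \<equiv> denom \<theta> t z L"
  assumes S: "S = map (\<lambda>r. entry a (t r) (z r)) [0..<L]"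
    and e: "\<And>r. r \<le> L \<Longrightarrow> e r \<noteq> 0" and z: "\<And>r. r < L \<Longrightarrow> z r \<noteq> 0"
  shows "strip_action (t_coef \<theta> t L / z_coef \<theta> z L) S =
    Some (map (\<lambda>r. entry a (t r * e r / e (Suc r)) (z r * e (Suc r) / e r)) [0..<L])"
proof -
  let ?b = "z_coef \<theta> z L" and ?c = "t_coef \<theta> t L" and ?D = "partial_D t z L L"
  have nz: "?b \<noteq> 0" "?c \<noteq> 0" "?D \<noteq> 0"
    using e[of 0] e[of L] by (auto simp: e_def denom_0 denom_end)
  have start: "(?c / ?b - 1) * strip_phi S =
      coef_diff \<theta> t z L * (\<Prod>s<0. t s) * (\<Prod>s\<in>{0..<L}. z s) / e 0"
    using nz by (simp add: strip_closed_forms[OF S] e_def denom_0 atLeast0LessThan field_simps)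
  have stop: "coef_diff \<theta> t z L * (\<Prod>s<L. t s) * (\<Prod>s\<in>{L..<L}. z s) / e L
      + (inverse (?c / ?b) - 1) * strip_eps S = 0"
    using nz by (simp add: strip_closed_forms[OF S] e_def denom_end field_simps)
  show ?thesis
    unfolding strip_action_def start
    using slide_through_closed_form[where \<theta> = \<theta> and t = t and z = z and L = L and r = 0 and a = a,
        folded e_def, OF e z] nz stop
    by (simp add: strip_closed_forms[OF S] S[symmetric])
qed

section \<open>The action on networks\<close>

text \<open>A pair of wires is given by the positions \<open>P r\<close>, \<open>Q r\<close> of its weights \<open>t\<close>, \<open>z\<close> on the
  orthogonal wire number \<open>r\<close>.\<close>

definition is_transfer ::
    "nat \<Rightarrow> (nat \<Rightarrow> nat \<times> nat) \<Rightarrow> (nat \<Rightarrow> nat \<times> nat) \<Rightarrow> (nat \<Rightarrow> complex) \<Rightarrow> network \<Rightarrow> network \<Rightarrow> bool"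
  where
  "is_transfer L P Q e N N' \<longleftrightarrow>
     (\<forall>r<L. N' (P r) = N (P r) * e r / e (Suc r)) \<and>
     (\<forall>r<L. N' (Q r) = N (Q r) * e (Suc r) / e r) \<and>
     (\<forall>p. p \<notin> P ` {..<L} \<union> Q ` {..<L} \<longrightarrow> N' p = N p)"

definition net_denom ::
    "crystal_op \<Rightarrow> nat \<Rightarrow> (nat \<Rightarrow> nat \<times> nat) \<Rightarrow> (nat \<Rightarrow> nat \<times> nat) \<Rightarrow> network \<Rightarrow> nat \<Rightarrow> complex" where
  "net_denom \<theta> L P Q N = denom \<theta> (\<lambda>r. N (P r)) (\<lambda>r. N (Q r)) L"

text \<open>Where the denominators do not vanish, \<open>F\<close> is given by the closed form. This is all that is
  needed of an operator, and it does not refer to the cut or to the sides of the wires: the same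
  \<open>F\<close> can be described in this way for several choices of \<open>P\<close> and \<open>Q\<close>.\<close>

definition realizes ::
    "nat \<Rightarrow> nat \<Rightarrow> (network \<rightharpoonup> network) \<Rightarrow> crystal_op \<Rightarrow> nat \<Rightarrow>
     (nat \<Rightarrow> nat \<times> nat) \<Rightarrow> (nat \<Rightarrow> nat \<times> nat) \<Rightarrow> bool" where
  "realizes n m F \<theta> L P Q \<longleftrightarrow>
     (\<forall>N \<in> torus_networks n m. (\<forall>r\<le>L. net_denom \<theta> L P Q N r \<noteq> 0) \<longrightarrow>
        (\<exists>N'. F N = Some N' \<and> is_transfer L P Q (net_denom \<theta> L P Q N) N N'))"

fun oriented :: "side \<Rightarrow> 'a \<Rightarrow> 'a \<Rightarrow> 'a \<times> 'a" where
  "oriented FromLeft p q = (p, q)"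
| "oriented FromRight p q = (q, p)"

lemma get_strip_oriented:
  "get_strip a (map (\<lambda>r. oriented a (P r) (Q r)) [0..<L]) N =
     map (\<lambda>r. entry a (N (P r)) (N (Q r))) [0..<L]"
  by (cases a) (auto simp: get_strip_def)

lemma put_strip_oriented:
  fixes N :: network and t z :: "nat \<Rightarrow> complex" and a :: side
  assumes "inj_on P {..<L}" "inj_on Q {..<L}" "P ` {..<L} \<inter> Q ` {..<L} = {}"
  defines "N' \<equiv> put_strip (map (\<lambda>r. oriented a (P r) (Q r)) [0..<L]) N
     (map (\<lambda>r. entry a (t r) (z r)) [0..<L])"
  shows "(\<forall>r<L. N' (P r) = t r) \<and> (\<forall>r<L. N' (Q r) = z r) \<and>
     (\<forall>p. p \<notin> P ` {..<L} \<union> Q ` {..<L} \<longrightarrow> N' p = N p)"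
  using assms(1-3) unfolding N'_def
proof (induction L)
  case 0
  show ?case by (simp add: put_strip_def)
next
  case (Suc L)
  define M where "M = put_strip (map (\<lambda>r. oriented a (P r) (Q r)) [0..<L]) N
     (map (\<lambda>r. entry a (t r) (z r)) [0..<L])"
  have M: "(\<forall>r<L. M (P r) = t r) \<and> (\<forall>r<L. M (Q r) = z r) \<and>
     (\<forall>p. p \<notin> P ` {..<L} \<union> Q ` {..<L} \<longrightarrow> M p = N p)"
    unfolding M_def by (rule Suc.IH) (use Suc.prems in \<open>auto simp: lessThan_Suc\<close>)
  have "P L \<noteq> Q L" using Suc.prems(3) by auto
  then have step: "put_strip (map (\<lambda>r. oriented a (P r) (Q r)) [0..<Suc L]) N
     (map (\<lambda>r. entry a (t r) (z r)) [0..<Suc L]) = M (P L := t L, Q L := z L)"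
    by (cases a) (simp_all add: put_strip_def M_def fun_upd_twist)
  have PQ: "P r \<noteq> P L" "Q r \<noteq> Q L" "P r \<noteq> Q L" "Q r \<noteq> P L" if "r < L" for r
    using that Suc.prems by (auto simp: lessThan_Suc) (metis imageI lessThan_iff)+
  show ?case unfolding step
    using M PQ \<open>P L \<noteq> Q L\<close> by (auto simp: less_Suc_eq lessThan_Suc)
qed

lemma realizes_wire_pair:
  assumes ps: "ps = map (\<lambda>r. oriented a (P r) (Q r)) [0..<L]"
    and P: "inj_on P {..<L}" and Q: "inj_on Q {..<L}" "P ` {..<L} \<inter> Q ` {..<L} = {}"
    and PQ: "P ` {..<L} \<union> Q ` {..<L} \<subseteq> {1..n} \<times> {1..m}"
    and F: "\<And>N. F N = map_option (put_strip ps N)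
      (strip_action (f (get_strip a ps N)) (get_strip a ps N))"
    and f: "\<And>S. \<theta> = Weyl \<Longrightarrow> f S = inverse (strip_phi S / strip_eps S)"
      "\<And>c S. \<theta> = Act c \<Longrightarrow> f S = c"
  shows "realizes n m F \<theta> L P Q"
  unfolding realizes_def
proof (intro ballI impI)
  fix N assume N: "N \<in> torus_networks n m" and e: "\<forall>r\<le>L. net_denom \<theta> L P Q N r \<noteq> 0"
  define S where "S = get_strip a ps N"
  have S: "S = map (\<lambda>r. entry a (N (P r)) (N (Q r))) [0..<L]"
    unfolding S_def ps by (rule get_strip_oriented)
  have z: "N (Q r) \<noteq> 0" if "r < L" for r
    using N PQ that unfolding torus_networks_def by (auto simp: PiE_iff)
  let ?t = "\<lambda>r. N (P r)" and ?z = "\<lambda>r. N (Q r)"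
  have e': "denom \<theta> ?t ?z L r \<noteq> 0" if "r \<le> L" for r
    using e that by (simp add: net_denom_def)
  have "partial_D ?t ?z L L \<noteq> 0" using e'[of 0] by (auto simp: denom_0)
  then have param: "f S = t_coef \<theta> ?t L / z_coef \<theta> ?z L"
    using f by (cases \<theta>) (simp_all add: strip_closed_forms[OF S] field_simps)
  define N' where "N' = put_strip ps N (map (\<lambda>r. entry a
      (N (P r) * net_denom \<theta> L P Q N r / net_denom \<theta> L P Q N (Suc r))
      (N (Q r) * net_denom \<theta> L P Q N (Suc r) / net_denom \<theta> L P Q N r)) [0..<L])"
  have "F N = Some N'"
    unfolding F S_def[symmetric] param net_denom_def N'_def
    using strip_action_closed_form[OF S e' z] by simp
  moreover have "is_transfer L P Q (net_denom \<theta> L P Q N) N N'"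
    unfolding is_transfer_def N'_def ps by (rule put_strip_oriented[OF P Q])
  ultimately show "\<exists>N'. F N = Some N' \<and> is_transfer L P Q (net_denom \<theta> L P Q N) N N'"
    by blast
qed



section \<open>Commutation of a row operator and a column operator\<close>

text \<open>The terms number \<open>l\<close> and \<open>l + 1\<close> of \<open>D\<close> share the factor contributed by the orthogonal wires
  other than \<open>l\<close> and \<open>l + 1\<close>.\<close>

definition block_coef :: "(nat \<Rightarrow> complex) \<Rightarrow> (nat \<Rightarrow> complex) \<Rightarrow> nat \<Rightarrow> nat \<Rightarrow> complex" where
  "block_coef t z L l = (\<Prod>r<l. t r) * (\<Prod>r\<in>{Suc (Suc l)..<L}. z r)"

lemma path_term_block:
  assumes "Suc l < L"
  shows "path_term t z L l = block_coef t z L l * z (Suc l)"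
    and "path_term t z L (Suc l) = block_coef t z L l * t l"
  using assms by (simp_all add: path_term_def block_coef_def prod.atLeast_Suc_lessThan)

lemma prefix_prod_eq:
  fixes f g :: "nat \<Rightarrow> complex"
  assumes "\<And>r. r < L \<Longrightarrow> r \<noteq> l \<Longrightarrow> r \<noteq> Suc l \<Longrightarrow> f r = g r" "f l * f (Suc l) = g l * g (Suc l)"
    and "s \<noteq> Suc l" "s \<le> L"
  shows "(\<Prod>r<s. f r) = (\<Prod>r<s. g r)"
proof (cases "s \<le> l")
  case True
  then show ?thesis using assms by (intro prod.cong) auto
next
  case False
  then have "Suc l < s" using assms(3) by auto
  then have split: "{..<s} = insert l (insert (Suc l) ({..<s} - {l, Suc l}))" by auto
  have "(\<Prod>r\<in>{..<s} - {l, Suc l}. f r) = (\<Prod>r\<in>{..<s} - {l, Suc l}. g r)"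
    using assms(1,4) by (intro prod.cong) auto
  then show ?thesis using assms(2) by (subst (1 2) split) (simp add: mult.assoc[symmetric])
qed

lemma suffix_prod_eq:
  fixes f g :: "nat \<Rightarrow> complex"
  assumes "\<And>r. r < L \<Longrightarrow> r \<noteq> l \<Longrightarrow> r \<noteq> Suc l \<Longrightarrow> f r = g r" "f l * f (Suc l) = g l * g (Suc l)"
    and "s \<noteq> Suc l" "Suc l < L"
  shows "(\<Prod>r\<in>{s..<L}. f r) = (\<Prod>r\<in>{s..<L}. g r)"
proof (cases "s \<le> l")
  case False
  then show ?thesis using assms by (intro prod.cong) auto
next
  case True
  then have split: "{s..<L} = insert l (insert (Suc l) ({s..<L} - {l, Suc l}))"
    using assms(4) by auto
  have "(\<Prod>r\<in>{s..<L} - {l, Suc l}. f r) = (\<Prod>r\<in>{s..<L} - {l, Suc l}. g r)"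
    using assms(1) by (intro prod.cong) auto
  then show ?thesis using assms(2) by (subst (1 2) split) (simp add: mult.assoc[symmetric])
qed

text \<open>A denominator other than number \<open>l + 1\<close> contains the terms \<open>l\<close> and \<open>l + 1\<close> of \<open>D\<close> with equal
  coefficients, hence only through \<open>z\<^sub>l\<^sub>+\<^sub>1 + t\<^sub>l\<close>; each other term depends on the four weights through the
  product \<open>t\<^sub>l t\<^sub>l\<^sub>+\<^sub>1\<close> or \<open>z\<^sub>l z\<^sub>l\<^sub>+\<^sub>1\<close>.\<close>

lemma denom_block_change:
  fixes t z t' z' :: "nat \<Rightarrow> complex"
  assumes l: "Suc l < L"
    and t: "\<And>r. r < L \<Longrightarrow> r \<noteq> l \<Longrightarrow> r \<noteq> Suc l \<Longrightarrow> t' r = t r" "t' l * t' (Suc l) = t l * t (Suc l)"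
    and z: "\<And>r. r < L \<Longrightarrow> r \<noteq> l \<Longrightarrow> r \<noteq> Suc l \<Longrightarrow> z' r = z r" "z' l * z' (Suc l) = z l * z (Suc l)"
    and tz: "z' (Suc l) + t' l = z (Suc l) + t l"
  shows "t_coef \<theta> t' L = t_coef \<theta> t L" "z_coef \<theta> z' L = z_coef \<theta> z L"
    and "r \<le> L \<Longrightarrow> r \<noteq> Suc l \<Longrightarrow> denom \<theta> t' z' L r = denom \<theta> t z L r"
    and "denom \<theta> t' z' L (Suc l) =
      denom \<theta> t z L l + coef_diff \<theta> t z L * (block_coef t z L l * z' (Suc l))"
proof -
  have pre: "(\<Prod>r<s. t' r) = (\<Prod>r<s. t r)" "(\<Prod>r<s. z' r) = (\<Prod>r<s. z r)"
    if "s \<noteq> Suc l" "s \<le> L" for s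
    using that prefix_prod_eq[of L l] t z by blast+
  have suf: "(\<Prod>r\<in>{s..<L}. z' r) = (\<Prod>r\<in>{s..<L}. z r)" if "s \<noteq> Suc l" for s
    by (rule suffix_prod_eq[of L l]) (use that z l in auto)
  show coefs: "t_coef \<theta> t' L = t_coef \<theta> t L" "z_coef \<theta> z' L = z_coef \<theta> z L"
    using pre[of L] l by (cases \<theta>; simp)+
  have far: "path_term t' z' L s = path_term t z L s" if "s < L" "s \<noteq> l" "s \<noteq> Suc l" for s
    using pre[of s] suf[of "Suc s"] that by (simp add: path_term_def)
  have block: "block_coef t' z' L l = block_coef t z L l"
    using pre[of l] suf[of "Suc (Suc l)"] l by (simp add: block_coef_def)
  have near: "path_term t' z' L l + path_term t' z' L (Suc l) =
      path_term t z L l + path_term t z L (Suc l)"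
    using tz by (simp add: path_term_block[OF l] block distrib_left[symmetric])
  have partial: "partial_D t' z' L r = partial_D t z L r" if "r \<le> L" "r \<noteq> Suc l" for r
  proof (cases "r \<le> l")
    case True
    then show ?thesis unfolding partial_D_def using that by (intro sum.cong refl far) auto
  next
    case False
    then have split: "{..<r} = insert l (insert (Suc l) ({..<r} - {l, Suc l}))"
      using that by auto
    have "(\<Sum>s\<in>{..<r} - {l, Suc l}. path_term t' z' L s) =
        (\<Sum>s\<in>{..<r} - {l, Suc l}. path_term t z L s)"
      using that by (intro sum.cong refl far) auto
    then show ?thesis unfolding partial_D_def
      using near by (subst (1 2) split) (simp add: add.assoc[symmetric])
  qed
  show "denom \<theta> t' z' L r = denom \<theta> t z L r" if "r \<le> L" "r \<noteq> Suc l"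
    using partial that partial[of L] l by (simp add: denom_def coefs)
  then have "denom \<theta> t' z' L l = denom \<theta> t z L l"
    using partial[of l] partial[of L] l by (simp add: denom_def coefs)
  then show "denom \<theta> t' z' L (Suc l) =
      denom \<theta> t z L l + coef_diff \<theta> t z L * (block_coef t z L l * z' (Suc l))"
    by (simp add: denom_Suc path_term_block[OF l] block coefs)
qed

text \<open>From here on \<open>x i j\<close> are the weights of a grid, and the notions are stated for row
  operators; those of column operators are obtained by transposing \<open>x\<close>.\<close>

definition grid_denom ::
    "crystal_op \<Rightarrow> nat \<Rightarrow> nat \<Rightarrow> (nat \<Rightarrow> nat \<Rightarrow> complex) \<Rightarrow> nat \<Rightarrow> complex" where
  "grid_denom \<theta> q k x = denom \<theta> (x k) (x (Suc k)) q"

definition corner_coef :: "crystal_op \<Rightarrow> nat \<Rightarrow> nat \<Rightarrow> nat \<Rightarrow> (nat \<Rightarrow> nat \<Rightarrow> complex) \<Rightarrow> complex" where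
  "corner_coef \<theta> q k l x = coef_diff \<theta> (x k) (x (Suc k)) q * block_coef (x k) (x (Suc k)) q l"

text \<open>This is the common denominator of the two composites at the four crossings of the two rows
  with the two columns. Its symmetry under transposition is the reason why the operators
  commute.\<close>

definition joint_denom ::
    "crystal_op \<Rightarrow> crystal_op \<Rightarrow> nat \<Rightarrow> nat \<Rightarrow> nat \<Rightarrow> nat \<Rightarrow> (nat \<Rightarrow> nat \<Rightarrow> complex) \<Rightarrow> complex" where
  "joint_denom \<theta> \<theta>' p q k l x =
     grid_denom \<theta> q k x (Suc l) * grid_denom \<theta>' p l (\<lambda>j i. x i j) (Suc k)
     + corner_coef \<theta> q k l x * corner_coef \<theta>' p l k (\<lambda>j i. x i j) * x k l * x (Suc k) (Suc l)"

lemma joint_denom_transpose: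
  "joint_denom \<theta>' \<theta> q p l k (\<lambda>j i. x i j) = joint_denom \<theta> \<theta>' p q k l x"
  by (simp add: joint_denom_def)

text \<open>The column operator preserves \<open>x (k + 1) (l + 1) + x k l\<close>: with \<open>v\<close>, \<open>u\<close> for these two weights,
  the column denominators satisfy \<open>f\<^sub>k\<^sub>+\<^sub>1 = f\<^sub>k + \<gamma> v\<close> and \<open>f\<^sub>k\<^sub>+\<^sub>2 = f\<^sub>k\<^sub>+\<^sub>1 + \<gamma> u\<close>, so that
  \<open>v f\<^sub>k\<^sub>+\<^sub>2 + u f\<^sub>k = (v + u) f\<^sub>k\<^sub>+\<^sub>1\<close>.\<close>

lemma grid_denom_after_column_op:
  fixes x y :: "nat \<Rightarrow> nat \<Rightarrow> complex" and \<theta>' :: crystal_op and p l :: nat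
  defines "f \<equiv> grid_denom \<theta>' p l (\<lambda>j i. x i j)"
  assumes kl: "Suc k < p" "Suc l < q"
    and f: "\<And>r. r \<le> p \<Longrightarrow> f r \<noteq> 0"
    and y: "\<And>i. i < p \<Longrightarrow> y i l = x i l * f i / f (Suc i)"
      "\<And>i. i < p \<Longrightarrow> y i (Suc l) = x i (Suc l) * f (Suc i) / f i"
      "\<And>i j. i < p \<Longrightarrow> j < q \<Longrightarrow> j \<noteq> l \<Longrightarrow> j \<noteq> Suc l \<Longrightarrow> y i j = x i j"
  shows "r \<le> q \<Longrightarrow> r \<noteq> Suc l \<Longrightarrow> grid_denom \<theta> q k y r = grid_denom \<theta> q k x r"
    and "grid_denom \<theta> q k y (Suc l) * f (Suc k) = joint_denom \<theta> \<theta>' p q k l x"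
proof -
  define \<gamma> where "\<gamma> = corner_coef \<theta>' p l k (\<lambda>j i. x i j)"
  have fk: "f k \<noteq> 0" "f (Suc k) \<noteq> 0" "f (Suc (Suc k)) \<noteq> 0" using f kl by auto
  have f1: "f (Suc k) = f k + \<gamma> * x (Suc k) (Suc l)" and f2: "f (Suc (Suc k)) = f (Suc k) + \<gamma> * x k l"
    unfolding f_def \<gamma>_def grid_denom_def corner_coef_def
    by (simp_all add: denom_Suc path_term_block[OF kl(1)] mult.assoc)
  have "y (Suc k) (Suc l) * f (Suc k) + y k l * f (Suc k) = (x (Suc k) (Suc l) + x k l) * f (Suc k)"
  proof -
    have "y (Suc k) (Suc l) * f (Suc k) + y k l * f (Suc k)
        = x (Suc k) (Suc l) * f (Suc (Suc k)) + x k l * f k"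
      using y(1)[of k] y(2)[of "Suc k"] kl fk by simp
    also have "\<dots> = (x (Suc k) (Suc l) + x k l) * f (Suc k)"
      unfolding f2 using f1 by algebra
    finally show ?thesis .
  qed
  then have tz: "y (Suc k) (Suc l) + y k l = x (Suc k) (Suc l) + x k l"
    using fk by (simp add: distrib_right[symmetric])
  have prods: "y i l * y i (Suc l) = x i l * x i (Suc l)" if "i < p" for i
    using y(1,2)[OF that] f[of i] f[of "Suc i"] that by simp
  note change = denom_block_change[OF kl(2), where \<theta> = \<theta> and t = "x k" and t' = "y k"
      and z = "x (Suc k)" and z' = "y (Suc k)"]
  show "grid_denom \<theta> q k y r = grid_denom \<theta> q k x r" if "r \<le> q" "r \<noteq> Suc l"
    unfolding grid_denom_def by (rule change(3)) (use y(3) prods tz kl that in auto)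
  have "grid_denom \<theta> q k y (Suc l) =
      grid_denom \<theta> q k x l + corner_coef \<theta> q k l x * y (Suc k) (Suc l)"
    unfolding grid_denom_def corner_coef_def
    by (subst change(4)) (use y(3) prods tz kl in \<open>auto simp: mult.assoc\<close>)
  also have "\<dots> * f (Suc k) = grid_denom \<theta> q k x l * f (Suc k)
      + corner_coef \<theta> q k l x * x (Suc k) (Suc l) * f (Suc (Suc k))"
    using y(2)[of "Suc k"] kl fk by (simp add: field_simps)
  also have "\<dots> = (grid_denom \<theta> q k x l + corner_coef \<theta> q k l x * x (Suc k) (Suc l)) * f (Suc k)
      + corner_coef \<theta> q k l x * \<gamma> * x k l * x (Suc k) (Suc l)"
    unfolding f2 by (simp add: algebra_simps)
  also have "grid_denom \<theta> q k x l + corner_coef \<theta> q k l x * x (Suc k) (Suc l)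
      = grid_denom \<theta> q k x (Suc l)"
    by (simp add: grid_denom_def corner_coef_def denom_Suc path_term_block[OF kl(2)] mult.assoc)
  finally show "grid_denom \<theta> q k y (Suc l) * f (Suc k) = joint_denom \<theta> \<theta>' p q k l x"
    by (simp add: joint_denom_def \<gamma>_def f_def)
qed

text \<open>The grid \<open>g\<close> assigns crossings to pairs of line numbers; allowing any size \<open>p \<times> q\<close> makes the
  transpose of a grid a grid again.\<close>

definition is_grid :: "nat \<Rightarrow> nat \<Rightarrow> nat \<Rightarrow> nat \<Rightarrow> (nat \<Rightarrow> nat \<Rightarrow> nat \<times> nat) \<Rightarrow> bool" where
  "is_grid n m p q g \<longleftrightarrow>
     bij_betw (\<lambda>(k, l). g k l) ({..<p} \<times> {..<q}) ({1..n} \<times> {1..m})"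

lemma is_grid_transpose:
  assumes "is_grid n m p q g"
  shows "is_grid n m q p (\<lambda>l k. g k l)"
proof -
  have "bij_betw prod.swap ({..<q} \<times> {..<p}) ({..<p} \<times> {..<q})"
    by (auto simp: bij_betw_def)
  from bij_betw_trans[OF this assms[unfolded is_grid_def]]
  show ?thesis unfolding is_grid_def by (simp add: comp_def case_prod_unfold)
qed

lemma is_grid_eq_iff:
  assumes "is_grid n m p q g" "i < p" "j < q" "i' < p" "j' < q"
  shows "g i j = g i' j' \<longleftrightarrow> i = i' \<and> j = j'"
proof -
  have "inj_on (\<lambda>(k, l). g k l) ({..<p} \<times> {..<q})"
    using assms(1) unfolding is_grid_def by (rule bij_betw_imp_inj_on)
  from inj_on_eq_iff[OF this, of "(i, j)" "(i', j')"] show ?thesis using assms by simp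
qed

lemma is_grid_in:
  assumes "is_grid n m p q g" "i < p" "j < q"
  shows "g i j \<in> {1..n} \<times> {1..m}"
  using bij_betwE[OF assms(1)[unfolded is_grid_def]] assms(2,3) by auto

lemma is_grid_row_subset:
  assumes "is_grid n m p q g" "i < p"
  shows "g i ` {..<q} \<subseteq> {1..n} \<times> {1..m}"
  using is_grid_in[OF assms] by blast

lemma is_grid_cases:
  assumes "is_grid n m p q g" "a \<in> {1..n} \<times> {1..m}"
  obtains i j where "i < p" "j < q" "a = g i j"
proof -
  have "a \<in> (\<lambda>(k, l). g k l) ` ({..<p} \<times> {..<q})"
    using bij_betw_imp_surj_on[OF assms(1)[unfolded is_grid_def]] assms(2) by simp
  then show ?thesis using that by auto
qed

lemma is_transfer_row:
  assumes g: "is_grid n m p q g" and k: "Suc k < p"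
    and tr: "is_transfer q (g k) (g (Suc k)) e N N'"
  shows "j < q \<Longrightarrow> N' (g k j) = N (g k j) * e j / e (Suc j)"
    and "j < q \<Longrightarrow> N' (g (Suc k) j) = N (g (Suc k) j) * e (Suc j) / e j"
    and "i < p \<Longrightarrow> j < q \<Longrightarrow> i \<noteq> k \<Longrightarrow> i \<noteq> Suc k \<Longrightarrow> N' (g i j) = N (g i j)"
proof -
  show "N' (g i j) = N (g i j)" if "i < p" "j < q" "i \<noteq> k" "i \<noteq> Suc k"
  proof -
    have "g i j \<notin> g k ` {..<q} \<union> g (Suc k) ` {..<q}"
      using that k by (auto simp: is_grid_eq_iff[OF g])
    then show ?thesis using tr unfolding is_transfer_def by blast
  qed
qed (use tr in \<open>auto simp: is_transfer_def\<close>)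

lemma is_transfer_torus_networks:
  assumes "is_transfer L P Q e N N'" "N \<in> torus_networks n m"
    and "\<And>r. r \<le> L \<Longrightarrow> e r \<noteq> 0" "P ` {..<L} \<union> Q ` {..<L} \<subseteq> {1..n} \<times> {1..m}"
  shows "N' \<in> torus_networks n m"
  unfolding torus_networks_def
proof (rule PiE_I)
  fix a assume "a \<in> {1..n} \<times> {1..m}"
  then have "N a \<noteq> 0" using assms(2) unfolding torus_networks_def by (auto simp: PiE_iff)
  show "N' a \<in> - {0}"
  proof (cases "a \<in> P ` {..<L} \<union> Q ` {..<L}")
    case True
    then show ?thesis using assms(1,3) \<open>N a \<noteq> 0\<close> unfolding is_transfer_def by auto
  next
    case False
    then have "N' a = N a" using assms(1) unfolding is_transfer_def by blast
    then show ?thesis using \<open>N a \<noteq> 0\<close> by simp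
  qed
next
  fix a assume "a \<notin> {1..n} \<times> {1..m}"
  then have "N' a = N a" using assms(1,4) unfolding is_transfer_def by blast
  also have "\<dots> = undefined"
    using assms(2) \<open>a \<notin> _\<close> unfolding torus_networks_def by (rule PiE_arb)
  finally show "N' a = undefined" .
qed

text \<open>Outside the four crossings of the two rows with the two columns, at most one of the operators
  acts, with denominators that the other one does not change. At the four crossings the factors
  of both operators are multiplied, and the denominators that did change combine into the joint
  denominator in either order.\<close>

lemma row_op_column_op_commute_at:
  fixes g :: "nat \<Rightarrow> nat \<Rightarrow> nat \<times> nat"
  assumes g: "is_grid n m p q g" and kl: "Suc k < p" "Suc l < q"
    and F: "realizes n m F \<theta> q (g k) (g (Suc k))"
    and G: "realizes n m G \<theta>' p (\<lambda>i. g i l) (\<lambda>i. g i (Suc l))"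
    and N: "N \<in> torus_networks n m"
    and e_nz: "\<And>r. r \<le> q \<Longrightarrow> grid_denom \<theta> q k (\<lambda>i j. N (g i j)) r \<noteq> 0"
    and f_nz: "\<And>r. r \<le> p \<Longrightarrow> grid_denom \<theta>' p l (\<lambda>j i. N (g i j)) r \<noteq> 0"
    and joint: "joint_denom \<theta> \<theta>' p q k l (\<lambda>i j. N (g i j)) \<noteq> 0"
  shows "\<exists>N' \<in> torus_networks n m. (F \<circ>\<^sub>m G) N = Some N' \<and> (G \<circ>\<^sub>m F) N = Some N'"
proof -
  let ?T = "torus_networks n m"
  define e where "e = (\<lambda>N. grid_denom \<theta> q k (\<lambda>i j. N (g i j)))"
  define f where "f = (\<lambda>N. grid_denom \<theta>' p l (\<lambda>j i. N (g i j)))"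
  note g' = is_grid_transpose[OF g]
  have row_in: "g k ` {..<q} \<union> g (Suc k) ` {..<q} \<subseteq> {1..n} \<times> {1..m}"
    and col_in: "(\<lambda>i. g i l) ` {..<p} \<union> (\<lambda>i. g i (Suc l)) ` {..<p} \<subseteq> {1..n} \<times> {1..m}"
    using kl by (intro Un_least image_subsetI is_grid_in[OF g]; simp)+
  have Fdef: "\<exists>N'. F M = Some N' \<and> is_transfer q (g k) (g (Suc k)) (e M) M N' \<and> N' \<in> ?T"
    if "M \<in> ?T" "\<And>r. r \<le> q \<Longrightarrow> e M r \<noteq> 0" for M
  proof -
    have "\<exists>N'. F M = Some N' \<and> is_transfer q (g k) (g (Suc k)) (e M) M N'"
      using F that unfolding realizes_def net_denom_def e_def grid_denom_def by blast
    then show ?thesis using is_transfer_torus_networks[OF _ that(1) _ row_in] that(2) by blast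
  qed
  have Gdef: "\<exists>N'. G M = Some N' \<and> is_transfer p (\<lambda>i. g i l) (\<lambda>i. g i (Suc l)) (f M) M N' \<and> N' \<in> ?T"
    if "M \<in> ?T" "\<And>r. r \<le> p \<Longrightarrow> f M r \<noteq> 0" for M
  proof -
    have "\<exists>N'. G M = Some N' \<and> is_transfer p (\<lambda>i. g i l) (\<lambda>i. g i (Suc l)) (f M) M N'"
      using G that unfolding realizes_def net_denom_def f_def grid_denom_def by blast
    then show ?thesis using is_transfer_torus_networks[OF _ that(1) _ col_in] that(2) by blast
  qed
  have e: "e N r \<noteq> 0" if "r \<le> q" for r using e_nz that by (simp add: e_def)
  have f: "f N r \<noteq> 0" if "r \<le> p" for r using f_nz that by (simp add: f_def)
  obtain N1 where N1: "F N = Some N1" "is_transfer q (g k) (g (Suc k)) (e N) N N1" "N1 \<in> ?T"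
    using Fdef[OF N e] by blast
  obtain N2 where N2: "G N = Some N2" "N2 \<in> ?T"
    "is_transfer p (\<lambda>i. g i l) (\<lambda>i. g i (Suc l)) (f N) N N2"
    using Gdef[OF N f] by blast
  note row1 = is_transfer_row[OF g kl(1) N1(2)]
  note col2 = is_transfer_row[OF g' kl(2) N2(3)]
  have e2: "e N2 r = e N r" if "r \<le> q" "r \<noteq> Suc l" for r
    unfolding e_def
    by (rule grid_denom_after_column_op(1)[OF kl, of \<theta>']) (use f col2 kl that in \<open>auto simp: f_def\<close>)
  have e2_joint: "e N2 (Suc l) * f N (Suc k) = joint_denom \<theta> \<theta>' p q k l (\<lambda>i j. N (g i j))"
    unfolding e_def f_def
    by (rule grid_denom_after_column_op(2)[OF kl]) (use f col2 kl in \<open>auto simp: f_def\<close>)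
  have f1: "f N1 r = f N r" if "r \<le> p" "r \<noteq> Suc k" for r
    unfolding f_def
    by (rule grid_denom_after_column_op(1)[OF kl(2,1), of \<theta>])
      (use e row1 kl that in \<open>auto simp: e_def\<close>)
  have f1_joint: "f N1 (Suc k) * e N (Suc l) = joint_denom \<theta> \<theta>' p q k l (\<lambda>i j. N (g i j))"
    unfolding e_def f_def
    by (subst joint_denom_transpose[symmetric], rule grid_denom_after_column_op(2)[OF kl(2,1)])
      (use e row1 kl in \<open>auto simp: e_def\<close>)
  have e2_nz: "e N2 r \<noteq> 0" if "r \<le> q" for r
    using e2[OF that] e[OF that] e2_joint joint by (cases "r = Suc l") auto
  have f1_nz: "f N1 r \<noteq> 0" if "r \<le> p" for r
    using f1[OF that] f[OF that] f1_joint joint by (cases "r = Suc k") auto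
  obtain N12 where N12: "F N2 = Some N12" "is_transfer q (g k) (g (Suc k)) (e N2) N2 N12" "N12 \<in> ?T"
    using Fdef[OF N2(2) e2_nz] by blast
  obtain N21 where N21: "G N1 = Some N21" "N21 \<in> ?T"
    "is_transfer p (\<lambda>i. g i l) (\<lambda>i. g i (Suc l)) (f N1) N1 N21"
    using Gdef[OF N1(3) f1_nz] by blast
  note row12 = is_transfer_row[OF g kl(1) N12(2)]
  note col21 = is_transfer_row[OF g' kl(2) N21(3)]
  have cross: "e N2 (Suc l) * f N (Suc k) = f N1 (Suc k) * e N (Suc l)"
    using e2_joint f1_joint by simp
  \<comment> \<open>\<open>cross_down\<close> serves the crossings \<open>(k, l)\<close> and \<open>(k + 1, l + 1)\<close>, where the changed
    denominators stand below the fraction bar, and \<open>cross_up\<close> the other two.\<close>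
  have cross_down: "c * a / f N (Suc k) * b / e N2 (Suc l) = c * b / e N (Suc l) * a / f N1 (Suc k)"
    for a b c
  proof -
    have "c * a / f N (Suc k) * b / e N2 (Suc l) = c * a * b / (e N2 (Suc l) * f N (Suc k))" by simp
    then show ?thesis unfolding cross by (simp add: mult_ac)
  qed
  have cross_up: "c * f N (Suc k) / a * e N2 (Suc l) / b = c * e N (Suc l) / b * f N1 (Suc k) / a"
    for a b c
  proof -
    have "c * f N (Suc k) / a * e N2 (Suc l) / b = c * (e N2 (Suc l) * f N (Suc k)) / (a * b)" by simp
    then show ?thesis unfolding cross by (simp add: mult_ac)
  qed
  have "N12 (g i j) = N21 (g i j)" if ij: "i < p" "j < q" for i j
  proof (cases "i = k \<or> i = Suc k"; cases "j = l \<or> j = Suc l")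
    assume "i = k \<or> i = Suc k" "j = l \<or> j = Suc l"
    then consider "i = k" "j = l" | "i = k" "j = Suc l" | "i = Suc k" "j = l"
      | "i = Suc k" "j = Suc l" by blast
    then show ?thesis
    proof cases
      case 1
      then show ?thesis using kl cross_down
        by (simp add: row12 col21 row1 col2 e2 f1)
    next
      case 2
      then show ?thesis using kl cross_up
        by (simp add: row12 col21 row1 col2 e2 f1)
    next
      case 3
      then show ?thesis using kl cross_up
        by (simp add: row12 col21 row1 col2 e2 f1)
    next
      case 4
      then show ?thesis using kl cross_down
        by (simp add: row12 col21 row1 col2 e2 f1)
    qed
  next
    assume "i = k \<or> i = Suc k" "\<not> (j = l \<or> j = Suc l)"
    then show ?thesis
      using row12 col21 row1 col2 ij kl e2 by auto
  next
    assume "\<not> (i = k \<or> i = Suc k)" "j = l \<or> j = Suc l"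
    then show ?thesis
      using row12 col21 row1 col2 ij kl f1 by auto
  next
    assume "\<not> (i = k \<or> i = Suc k)" "\<not> (j = l \<or> j = Suc l)"
    then show ?thesis
      using row12 col21 row1 col2 ij kl by auto
  qed
  then have "N12 a = N21 a" if "a \<in> {1..n} \<times> {1..m}" for a
    using is_grid_cases[OF g that] by metis
  then have "N12 = N21"
    using N12(3) N21(2) unfolding torus_networks_def by (intro PiE_ext) auto
  then show ?thesis using N1 N2 N12 N21 by (auto simp: map_comp_def)
qed

section \<open>Genericity\<close>

lemma denom_poly_functions:
  assumes "P ` {..<L} \<subseteq> A" "Q ` {..<L} \<subseteq> A" "r \<le> L"
  shows "(\<lambda>N. net_denom \<theta> L P Q N r) \<in> poly_functions A"
proof -
  have "(\<lambda>N. path_term (\<lambda>r. N (P r)) (\<lambda>r. N (Q r)) L s) \<in> poly_functions A" if "s < L" for s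
    unfolding path_term_def using assms that
    by (intro poly_functions.mult poly_functions_prod poly_functions.coord) auto
  then have "(\<lambda>N. partial_D (\<lambda>r. N (P r)) (\<lambda>r. N (Q r)) L r) \<in> poly_functions A" if "r \<le> L" for r
    unfolding partial_D_def using that by (intro poly_functions_sum) auto
  moreover have "(\<lambda>N. t_coef \<theta> (\<lambda>r. N (P r)) L) \<in> poly_functions A"
    using assms by (cases \<theta>) (auto intro!: poly_functions_prod poly_functions.coord poly_functions.const)
  moreover have "(\<lambda>N. z_coef \<theta> (\<lambda>r. N (Q r)) L) \<in> poly_functions A"
    using assms by (cases \<theta>) (auto intro!: poly_functions_prod poly_functions.coord poly_functions.const)
  ultimately show ?thesis
    unfolding net_denom_def denom_def using assms(3)
    by (intro poly_functions.add poly_functions.mult poly_functions_diff) auto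
qed

lemma corner_coef_poly_functions:
  assumes "g k ` {..<q} \<subseteq> A" "g (Suc k) ` {..<q} \<subseteq> A" "l \<le> q"
  shows "(\<lambda>N. corner_coef \<theta> q k l (\<lambda>i j. N (g i j))) \<in> poly_functions A"
proof -
  have "(\<lambda>N. t_coef \<theta> (\<lambda>r. N (g k r)) q) \<in> poly_functions A"
    using assms by (cases \<theta>) (auto intro!: poly_functions_prod poly_functions.coord poly_functions.const)
  moreover have "(\<lambda>N. z_coef \<theta> (\<lambda>r. N (g (Suc k) r)) q) \<in> poly_functions A"
    using assms by (cases \<theta>) (auto intro!: poly_functions_prod poly_functions.coord poly_functions.const)
  ultimately show ?thesis
    unfolding corner_coef_def block_coef_def using assms
    by (intro poly_functions.mult poly_functions_prod poly_functions_diff poly_functions.coord) auto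
qed

text \<open>The operator \<open>e\<^sup>0\<close> is undefined everywhere.\<close>

fun proper_op :: "crystal_op \<Rightarrow> bool" where
  "proper_op (Act c) \<longleftrightarrow> c \<noteq> 0"
| "proper_op Weyl \<longleftrightarrow> True"

text \<open>For \<open>Act c\<close> the weights \<open>t\<close> are \<open>0\<close> and all others \<open>1\<close>, so that only the first term of \<open>D\<close>
  survives and each denominator is \<open>1\<close> or \<open>c\<close>; more positive terms could cancel for a complex
  number \<open>c\<close>. For \<open>Weyl\<close> this choice would make the coefficient \<open>\<Prod>t\<close> vanish, but when all weights
  are \<open>1\<close>, both coefficients are \<open>1\<close>.\<close>

definition base_point :: "crystal_op \<Rightarrow> nat \<Rightarrow> (nat \<Rightarrow> nat \<times> nat) \<Rightarrow> network" where
  "base_point \<theta> L P = (\<lambda>a. if \<theta> \<noteq> Weyl \<and> a \<in> P ` {..<L} then 0 else 1)"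

lemma net_denom_base_point:
  assumes "proper_op \<theta>" "0 < L" "r \<le> L" "P ` {..<L} \<inter> Q ` {..<L} = {}"
  shows "net_denom \<theta> L P Q (base_point \<theta> L P) r \<noteq> 0"
proof -
  let ?t = "\<lambda>r. base_point \<theta> L P (P r)" and ?z = "\<lambda>r. base_point \<theta> L P (Q r)"
  have z: "?z r = 1" if "r < L" for r
    using assms(4) that by (auto simp: base_point_def)
  show ?thesis
  proof (cases \<theta>)
    case (Act c)
    have t: "?t r = 0" if "r < L" for r
      using that Act by (auto simp: base_point_def)
    have "path_term ?t ?z L s = (if s = 0 then 1 else 0)" if "s < L" for s
    proof (cases "s = 0")
      case False
      then have "(\<Prod>r<s. ?t r) = 0" using t[of 0] assms(2) by (auto intro!: prod_zero)
      then show ?thesis using False by (simp add: path_term_def)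
    qed (simp add: path_term_def z)
    then have "partial_D ?t ?z L r = (if r = 0 then 0 else 1)" if "r \<le> L" for r
      using that by (simp add: partial_D_def)
    then show ?thesis
      using Act assms(1-3) by (simp add: net_denom_def denom_def)
  next
    case Weyl
    then show ?thesis
      using assms(2)
      by (simp add: net_denom_def denom_def partial_D_def path_term_def base_point_def)
  qed
qed

lemma grid_rows_disjoint:
  assumes "is_grid n m p q g" "Suc k < p"
  shows "g k ` {..<q} \<inter> g (Suc k) ` {..<q} = {}"
  using assms(2) by (auto simp: is_grid_eq_iff[OF assms(1)])

text \<open>The joint denominator is the product of a row and a column denominator plus a correction. On
  the line through the base points of the two operators the correction vanishes identically: for
  a Weyl generator its two lines carry equal weights, hence equal coefficients, and otherwise the
  weight at \<open>(k, l)\<close> is \<open>0\<close>. Each factor of the product is nonzero at one of the base points.\<close>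

lemma joint_denom_nonzero:
  assumes g: "is_grid n m p q g" and kl: "Suc k < p" "Suc l < q"
    and ops: "proper_op \<theta>" "proper_op \<theta>'"
  shows "\<exists>N. joint_denom \<theta> \<theta>' p q k l (\<lambda>i j. N (g i j)) \<noteq> 0"
proof -
  let ?A = "{1..n} \<times> {1..m}"
  let ?e = "\<lambda>N. net_denom \<theta> q (g k) (g (Suc k)) N (Suc l)"
  let ?f = "\<lambda>N. net_denom \<theta>' p (\<lambda>i. g i l) (\<lambda>i. g i (Suc l)) N (Suc k)"
  define x where "x = base_point \<theta> q (g k)"
  define y where "y = base_point \<theta>' p (\<lambda>i. g i l)"
  note g' = is_grid_transpose[OF g]
  have "\<exists>\<tau>. \<forall>h \<in> {?e, ?f}. h (\<lambda>a. x a + \<tau> * (y a - x a)) \<noteq> 0"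
  proof (rule common_nonzero_on_line[where A = ?A])
    have "?e \<in> poly_functions ?A"
      by (rule denom_poly_functions) (use kl is_grid_row_subset[OF g] is_grid_row_subset[OF g'] in simp_all)
    moreover have "?f \<in> poly_functions ?A"
      by (rule denom_poly_functions) (use kl is_grid_row_subset[OF g] is_grid_row_subset[OF g'] in simp_all)
    ultimately show "{?e, ?f} \<subseteq> poly_functions ?A" by blast
    have "?e x \<noteq> 0" unfolding x_def
      by (rule net_denom_base_point) (use kl ops grid_rows_disjoint[OF g] in auto)
    moreover have "?f y \<noteq> 0" unfolding y_def
      by (rule net_denom_base_point) (use kl ops grid_rows_disjoint[OF g'] in auto)
    ultimately show "h x \<noteq> 0 \<or> h y \<noteq> 0" if "h \<in> {?e, ?f}" for h using that by blast
  qed simp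
  then obtain \<tau> where \<tau>: "?e (\<lambda>a. x a + \<tau> * (y a - x a)) \<noteq> 0" "?f (\<lambda>a. x a + \<tau> * (y a - x a)) \<noteq> 0"
    by auto
  define N where "N = (\<lambda>a. x a + \<tau> * (y a - x a))"
  define X where "X = (\<lambda>i j. N (g i j))"
  have col: "g i j \<in> (\<lambda>i. g i l) ` {..<p} \<longleftrightarrow> j = l" if "i < p" "j < q" for i j
    using that kl by (auto simp: is_grid_eq_iff[OF g])
  have row: "g i j \<in> g k ` {..<q} \<longleftrightarrow> i = k" if "i < p" "j < q" for i j
    using that kl by (auto simp: is_grid_eq_iff[OF g])
  have "corner_coef \<theta> q k l X * corner_coef \<theta>' p l k (\<lambda>j i. X i j) * X k l = 0"
  proof -
    consider "\<theta> = Weyl" | "\<theta>' = Weyl" | "\<theta> \<noteq> Weyl" "\<theta>' \<noteq> Weyl" by blast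
    then show ?thesis
    proof cases
      case 1
      have "X k j = X (Suc k) j" if "j < q" for j
        using that kl by (simp add: X_def N_def x_def y_def base_point_def 1 col)
      then have "(\<Prod>j<q. X k j) = (\<Prod>j<q. X (Suc k) j)" by (intro prod.cong) auto
      then show ?thesis by (simp add: corner_coef_def 1)
    next
      case 2
      have "X i l = X i (Suc l)" if "i < p" for i
        using that kl by (simp add: X_def N_def x_def y_def base_point_def 2 row)
      then have "(\<Prod>i<p. X i l) = (\<Prod>i<p. X i (Suc l))" by (intro prod.cong) auto
      then show ?thesis by (simp add: corner_coef_def 2)
    next
      case 3
      then have "X k l = 0"
        using kl by (simp add: X_def N_def x_def y_def base_point_def row col)
      then show ?thesis by simp
    qed
  qed
  then have "joint_denom \<theta> \<theta>' p q k l X = ?e N * ?f N"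
    by (simp add: joint_denom_def grid_denom_def net_denom_def X_def)
  then have "joint_denom \<theta> \<theta>' p q k l X \<noteq> 0"
    using \<tau> unfolding N_def[symmetric] by simp
  then show ?thesis unfolding X_def by blast
qed

theorem row_op_column_op_commute:
  assumes g: "is_grid n m p q g" and kl: "Suc k < p" "Suc l < q"
    and F: "realizes n m F \<theta> q (g k) (g (Suc k))" "proper_op \<theta>"
    and G: "realizes n m G \<theta>' p (\<lambda>i. g i l) (\<lambda>i. g i (Suc l))" "proper_op \<theta>'"
  shows "rationally_commute n m F G"
proof -
  let ?A = "{1..n} \<times> {1..m}"
  define e where "e = (\<lambda>r N. net_denom \<theta> q (g k) (g (Suc k)) N r)"
  define f where "f = (\<lambda>r N. net_denom \<theta>' p (\<lambda>i. g i l) (\<lambda>i. g i (Suc l)) N r)"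
  define J where "J = (\<lambda>N :: network. joint_denom \<theta> \<theta>' p q k l (\<lambda>i j. N (g i j)))"
  \<comment> \<open>everything that must not vanish for both composites to be given by the closed forms\<close>
  define \<F> where "\<F> = e ` {..q} \<union> f ` {..p} \<union> {J}"
  note g' = is_grid_transpose[OF g]
  have e: "e r \<in> poly_functions ?A" if "r \<le> q" for r
    unfolding e_def by (rule denom_poly_functions) (use that kl is_grid_row_subset[OF g] is_grid_row_subset[OF g'] in simp_all)
  have f: "f r \<in> poly_functions ?A" if "r \<le> p" for r
    unfolding f_def by (rule denom_poly_functions) (use that kl is_grid_row_subset[OF g] is_grid_row_subset[OF g'] in simp_all)
  have corner: "(\<lambda>N. corner_coef \<theta> q k l (\<lambda>i j. N (g i j))) \<in> poly_functions ?A"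
      "(\<lambda>N. corner_coef \<theta>' p l k (\<lambda>j i. N (g i j))) \<in> poly_functions ?A"
    by (rule corner_coef_poly_functions;
        use kl is_grid_row_subset[OF g] is_grid_row_subset[OF g'] in simp)+
  have coords: "(\<lambda>N. N (g k l)) \<in> poly_functions ?A"
      "(\<lambda>N. N (g (Suc k) (Suc l))) \<in> poly_functions ?A"
    by (rule poly_functions.coord, rule is_grid_in[OF g]; use kl in simp)+
  have "J = (\<lambda>N. e (Suc l) N * f (Suc k) N
      + corner_coef \<theta> q k l (\<lambda>i j. N (g i j)) * corner_coef \<theta>' p l k (\<lambda>j i. N (g i j))
        * N (g k l) * N (g (Suc k) (Suc l)))"
    by (simp add: J_def e_def f_def joint_denom_def grid_denom_def net_denom_def)
  also have "\<dots> \<in> poly_functions ?A"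
    by (intro poly_functions.add poly_functions.mult e f corner coords) (use kl in simp_all)
  finally have "\<F> \<subseteq> poly_functions ?A" using e f by (auto simp: \<F>_def)
  have nonzero: "\<exists>N. h N \<noteq> 0" if "h \<in> \<F>" for h
  proof -
    have "\<exists>N. e r N \<noteq> 0" if "r \<le> q" for r
      unfolding e_def
      by (rule exI, rule net_denom_base_point) (use that kl F grid_rows_disjoint[OF g] in auto)
    moreover have "\<exists>N. f r N \<noteq> 0" if "r \<le> p" for r
      unfolding f_def
      by (rule exI, rule net_denom_base_point) (use that kl G grid_rows_disjoint[OF g'] in auto)
    moreover have "\<exists>N. J N \<noteq> 0"
      unfolding J_def by (rule joint_denom_nonzero[OF g kl F(2) G(2)])
    ultimately show ?thesis using that unfolding \<F>_def by auto
  qed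
  have "finite \<F>" by (simp add: \<F>_def)
  from common_nonzero_torus_network[OF this \<open>\<F> \<subseteq> _\<close> nonzero]
  have "\<exists>N \<in> torus_networks n m. (\<Prod>h\<in>\<F>. h N) \<noteq> 0"
    using \<open>finite \<F>\<close> by auto
  moreover have "(\<lambda>N. \<Prod>h\<in>\<F>. h N) \<in> poly_functions ?A"
    using \<open>\<F> \<subseteq> _\<close> by (intro poly_functions_prod) auto
  moreover have "\<exists>N' \<in> torus_networks n m. (F \<circ>\<^sub>m G) N = Some N' \<and> (G \<circ>\<^sub>m F) N = Some N'"
    if "N \<in> torus_networks n m" "(\<Prod>h\<in>\<F>. h N) \<noteq> 0" for N
  proof (rule row_op_column_op_commute_at[OF g kl F(1) G(1) that(1)])
    have nz: "h N \<noteq> 0" if "h \<in> \<F>" for h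
      using \<open>(\<Prod>h\<in>\<F>. h N) \<noteq> 0\<close> \<open>finite \<F>\<close> that by auto
    show "grid_denom \<theta> q k (\<lambda>i j. N (g i j)) r \<noteq> 0" if "r \<le> q" for r
      using nz[of "e r"] that by (simp add: \<F>_def e_def net_denom_def grid_denom_def)
    show "grid_denom \<theta>' p l (\<lambda>j i. N (g i j)) r \<noteq> 0" if "r \<le> p" for r
      using nz[of "f r"] that by (simp add: \<F>_def f_def net_denom_def grid_denom_def)
    show "joint_denom \<theta> \<theta>' p q k l (\<lambda>i j. N (g i j)) \<noteq> 0"
      using nz[of J] by (simp add: \<F>_def J_def)
  qed
  ultimately show ?thesis
    unfolding rationally_commute_def rational_map_eq_def
    by (intro bexI[of _ "\<lambda>N. \<Prod>h\<in>\<F>. h N"] conjI ballI impI)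
qed

section \<open>Moving the cut\<close>

text \<open>With the coefficients \<open>\<Prod>t\<close> and \<open>\<Prod>z\<close>, the denominator number \<open>r\<close> is up to a monomial the sum
  \<open>D\<close> taken along the wires from the position \<open>r\<close> once around the cylinder. It is therefore
  compatible with a shift of the starting point.\<close>

lemma denom_Weyl_rotate:
  fixes t z t' z' :: "nat \<Rightarrow> complex" and K :: nat
  defines "L \<equiv> Suc K"
  assumes t': "\<And>r. r < L \<Longrightarrow> t' r = t (Suc r mod L)" and z': "\<And>r. r < L \<Longrightarrow> z' r = z (Suc r mod L)"
    and r: "r < L"
  shows "t 0 * denom Weyl t' z' L r = z 0 * denom Weyl t z L (Suc r)"
proof -
  let ?T = "\<Prod>r<L. t r" and ?Z = "\<Prod>r<L. z r"
  have t_shift: "t' r = t (Suc r)" and z_shift: "z' r = z (Suc r)" if "r < K" for r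
    using that t' z' by (auto simp: L_def)
  have last: "t' K = t 0" "z' K = z 0" using t' z' by (auto simp: L_def)
  have prods: "(\<Prod>r<L. t' r) = ?T" "(\<Prod>r<L. z' r) = ?Z"
    unfolding L_def
    by (subst prod.lessThan_Suc, subst prod.lessThan_Suc_shift,
        simp add: last t_shift z_shift mult.commute)+
  have term_shift: "t 0 * path_term t' z' L s = z 0 * path_term t z L (Suc s)" if "s < K" for s
  proof -
    have "t 0 * (\<Prod>r<s. t' r) = (\<Prod>r<Suc s. t r)"
      using that by (subst prod.lessThan_Suc_shift) (simp add: t_shift)
    moreover have "(\<Prod>r\<in>{Suc s..<L}. z' r) = (\<Prod>r\<in>{Suc s..<K}. z (Suc r)) * z 0"
      unfolding L_def using that by (simp add: last z_shift)
    moreover have "(\<Prod>r\<in>{Suc s..<K}. z (Suc r)) = (\<Prod>r\<in>{Suc (Suc s)..<L}. z r)"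
      by (simp only: L_def prod.shift_bounds_Suc_ivl)
    ultimately show ?thesis by (simp add: path_term_def mult_ac)
  qed
  have term_last: "t 0 * path_term t' z' L K = ?T"
    unfolding L_def by (subst prod.lessThan_Suc_shift) (simp add: path_term_def t_shift)
  have term_first: "z 0 * path_term t z L 0 = ?Z"
    using path_term_mult_z[of 0 L t z] by (simp add: L_def mult.commute atLeast0LessThan)
  have partial: "t 0 * partial_D t' z' L r = z 0 * partial_D t z L (Suc r) - ?Z" if "r \<le> K" for r
  proof -
    have "t 0 * partial_D t' z' L r = (\<Sum>s<r. z 0 * path_term t z L (Suc s))"
      unfolding partial_D_def sum_distrib_left using that by (intro sum.cong refl term_shift) auto
    also have "\<dots> = z 0 * partial_D t z L (Suc r) - ?Z"
      unfolding partial_D_def term_first[symmetric]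
      by (subst sum.lessThan_Suc_shift) (simp add: sum_distrib_left algebra_simps)
    finally show ?thesis .
  qed
  have total: "t 0 * partial_D t' z' L L = z 0 * partial_D t z L L - ?Z + ?T"
    using partial[of K] term_last by (simp add: L_def partial_D_Suc distrib_left)
  have "t 0 * denom Weyl t' z' L r =
      ?T * (t 0 * partial_D t' z' L r) + ?Z * (t 0 * partial_D t' z' L L - t 0 * partial_D t' z' L r)"
    by (simp add: denom_def prods algebra_simps)
  also have "\<dots> = z 0 * denom Weyl t z L (Suc r)"
    unfolding total partial[of r, OF r[unfolded L_def less_Suc_eq_le]]
    by (simp add: denom_def algebra_simps)
  finally show ?thesis .
qed

lemma denom_Weyl_ends:
  "denom Weyl t z L L * (\<Prod>r<L. z r) = denom Weyl t z L 0 * (\<Prod>r<L. t r)"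
  by (simp add: denom_0 denom_end)

lemma bij_betw_Suc_mod: "bij_betw (\<lambda>k. Suc k mod p) {..<p} {..<p}"
proof -
  have inj: "inj_on (\<lambda>k. Suc k mod p) {..<p}"
    by (rule inj_onI) (auto simp: mod_Suc split: if_splits)
  moreover have "(\<lambda>k. Suc k mod p) ` {..<p} \<subseteq> {..<p}" by auto
  ultimately show ?thesis by (simp add: bij_betw_def endo_inj_surj)
qed

text \<open>Only ratios of consecutive denominators enter the closed form, and these are shifted
  cyclically: the common factor \<open>c\<close> cancels, also in the last ratio, where both denominators pick
  up the factor \<open>\<Prod>t / \<Prod>z\<close>.\<close>

lemma realizes_Weyl_rotate:
  assumes F: "realizes n m F Weyl L P Q"
    and PQ: "P ` {..<L} \<subseteq> {1..n} \<times> {1..m}" "Q ` {..<L} \<subseteq> {1..n} \<times> {1..m}" and "0 < L"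
  shows "realizes n m F Weyl L (\<lambda>r. P (Suc r mod L)) (\<lambda>r. Q (Suc r mod L))"
  unfolding realizes_def
proof (intro ballI impI)
  fix N
  let ?P = "\<lambda>r. P (Suc r mod L)" and ?Q = "\<lambda>r. Q (Suc r mod L)"
  define e where "e = net_denom Weyl L P Q N"
  define e' where "e' = net_denom Weyl L ?P ?Q N"
  assume N: "N \<in> torus_networks n m" and "\<forall>r\<le>L. net_denom Weyl L ?P ?Q N r \<noteq> 0"
  then have e'_nz: "e' r \<noteq> 0" if "r \<le> L" for r using that by (simp add: e'_def)
  obtain K where K: "L = Suc K" using \<open>0 < L\<close> gr0_implies_Suc by blast
  have weight: "N a \<noteq> 0" if "a \<in> {1..n} \<times> {1..m}" for a
    using N that unfolding torus_networks_def by (auto simp: PiE_iff)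
  have PQ_nz: "N (P r) \<noteq> 0" "N (Q r) \<noteq> 0" if "r < L" for r
    by (rule weight; use PQ that in blast)+
  define T where "T = (\<Prod>r<L. N (P r))"
  define Z where "Z = (\<Prod>r<L. N (Q r))"
  have TZ: "T \<noteq> 0" "Z \<noteq> 0" using PQ_nz by (auto simp: T_def Z_def)
  define c where "c = N (Q 0) / N (P 0)"
  have c: "c \<noteq> 0" using PQ_nz[of 0] K by (simp add: c_def)
  have shift: "e' r = c * e (Suc r)" if "r < L" for r
    using denom_Weyl_rotate[of K "\<lambda>r. N (?P r)" "\<lambda>r. N (P r)" "\<lambda>r. N (?Q r)" "\<lambda>r. N (Q r)" r] that PQ_nz[of 0]
    by (simp add: e_def e'_def net_denom_def K c_def field_simps)
  note rot = bij_betw_Suc_mod[of L]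
  have "e L * Z = e 0 * T" "e' L * Z = e' 0 * T"
    using denom_Weyl_ends[of "\<lambda>r. N (P r)" "\<lambda>r. N (Q r)" L]
      denom_Weyl_ends[of "\<lambda>r. N (?P r)" "\<lambda>r. N (?Q r)" L]
      prod.reindex_bij_betw[OF rot, of "\<lambda>r. N (P r)"] prod.reindex_bij_betw[OF rot, of "\<lambda>r. N (Q r)"]
    by (simp_all add: e_def e'_def net_denom_def T_def Z_def)
  then have ends: "e L = e 0 * T / Z" "e' L = c * e 1 * T / Z"
    using TZ shift[of 0] K by (simp_all add: field_simps)
  have e_nz: "e r \<noteq> 0" if "r \<le> L" for r
  proof (cases r)
    case 0
    then show ?thesis using shift[of K] e'_nz[of K] ends(1) K by auto
  next
    case (Suc r')
    then show ?thesis using shift[of r'] e'_nz[of r'] that by auto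
  qed
  have ratio: "e' r / e' (Suc r) = e (Suc r mod L) / e (Suc (Suc r mod L))"
      "e' (Suc r) / e' r = e (Suc (Suc r mod L)) / e (Suc r mod L)" if "r < L" for r
  proof -
    show *: "e' r / e' (Suc r) = e (Suc r mod L) / e (Suc (Suc r mod L))"
    proof (cases "Suc r = L")
      case True
      then have "e' r / e' (Suc r) = c * (e 0 * T / Z) / (c * e 1 * T / Z)"
        using shift[of r] ends that by simp
      then show ?thesis using c TZ True by simp
    next
      case False
      then show ?thesis using shift[of r] shift[of "Suc r"] c that by simp
    qed
    show "e' (Suc r) / e' r = e (Suc (Suc r mod L)) / e (Suc r mod L)"
      using arg_cong[OF *, of inverse] by simp
  qed
  obtain N' where N': "F N = Some N'" "is_transfer L P Q e N N'"
    using F N e_nz unfolding realizes_def e_def by blast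
  have "?P ` {..<L} = P ` {..<L}" "?Q ` {..<L} = Q ` {..<L}"
    using bij_betw_imp_surj_on[OF rot] by (metis image_image)+
  then have "is_transfer L ?P ?Q e' N N'"
    using N'(2) ratio \<open>0 < L\<close> unfolding is_transfer_def
    by (simp add: times_divide_eq_right[symmetric] del: times_divide_eq_right)
  then show "\<exists>N'. F N = Some N' \<and> is_transfer L ?P ?Q (net_denom Weyl L ?P ?Q N) N N'"
    using N'(1) by (simp add: e'_def)
qed

lemma is_grid_rotate:
  assumes "is_grid n m p q g"
  shows "is_grid n m p q (\<lambda>k l. g (Suc k mod p) l)"
proof -
  have "bij_betw (map_prod (\<lambda>k. Suc k mod p) id) ({..<p} \<times> {..<q}) ({..<p} \<times> {..<q})"
    by (rule bij_betw_map_prod[OF bij_betw_Suc_mod]) simp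
  from bij_betw_trans[OF this assms[unfolded is_grid_def]]
  show ?thesis unfolding is_grid_def by (simp add: comp_def case_prod_unfold map_prod_def)
qed

lemma rationally_commute_sym: "rationally_commute n m F G \<Longrightarrow> rationally_commute n m G F"
  unfolding rationally_commute_def rational_map_eq_def by blast

text \<open>If the columns are the last and the first one, all columns are renumbered by one. The column
  operator is not affected, as the cut that moves is parallel to its wires, and the row operator
  has the same closed form with respect to the new cut.\<close>

lemma Weyl_row_commutes_with_cyclic_column_op:
  assumes g: "is_grid n m p q g" and kl: "Suc k < p" "l < q" "2 \<le> q"
    and F: "realizes n m F Weyl q (g k) (g (Suc k))"
    and G: "realizes n m G \<theta> p (\<lambda>i. g i l) (\<lambda>i. g i (Suc l mod q))" "proper_op \<theta>"
  shows "rationally_commute n m F G"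
proof (cases "Suc l < q")
  case True
  then show ?thesis using row_op_column_op_commute[OF g kl(1) True F _ _ G(2)] G(1) by simp
next
  case False
  then have l: "l = q - 1" "Suc (q - 2) = q - 1" "Suc (q - 1) = q" using kl by auto
  let ?g = "\<lambda>i j. g i (Suc j mod q)"
  have "is_grid n m p q ?g"
    using is_grid_transpose[OF is_grid_rotate[OF is_grid_transpose[OF g]]] .
  moreover have "Suc (q - 2) < q" using kl by simp
  moreover have "realizes n m F Weyl q (?g k) (?g (Suc k))"
    using realizes_Weyl_rotate[OF F] is_grid_row_subset[OF g] kl by simp
  moreover have "realizes n m G \<theta> p (\<lambda>i. ?g i (q - 2)) (\<lambda>i. ?g i (Suc (q - 2)))"
    using G(1) l kl by simp
  ultimately show ?thesis using row_op_column_op_commute kl(1) G(2) by fastforce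
qed

lemma cyclic_Weyl_ops_commute:
  assumes g: "is_grid n m p q g" and kl: "k < p" "l < q" "2 \<le> p" "2 \<le> q"
    and F: "realizes n m F Weyl q (g k) (g (Suc k mod p))"
    and G: "realizes n m G Weyl p (\<lambda>i. g i l) (\<lambda>i. g i (Suc l mod q))"
  shows "rationally_commute n m F G"
proof (cases "Suc k < p")
  case True
  then show ?thesis
    using Weyl_row_commutes_with_cyclic_column_op[OF g True kl(2,4) _ G] F by simp
next
  case False
  then have k: "k = p - 1" "Suc (p - 2) = p - 1" "Suc (p - 1) = p" using kl by auto
  let ?g = "\<lambda>i j. g (Suc i mod p) j"
  have "is_grid n m p q ?g" by (rule is_grid_rotate[OF g])
  moreover have "Suc (p - 2) < p" using kl by simp
  moreover have "realizes n m F Weyl q (?g (p - 2)) (?g (Suc (p - 2)))"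
    using F k kl by simp
  moreover have "realizes n m G Weyl p (\<lambda>i. ?g i l) (\<lambda>i. ?g i (Suc l mod q))"
    using realizes_Weyl_rotate[OF G] is_grid_row_subset[OF is_grid_transpose[OF g]] kl by simp
  ultimately show ?thesis
    using Weyl_row_commutes_with_cyclic_column_op[of n m p q ?g "p - 2" l F G Weyl] kl by simp
qed

section \<open>The wires of the torus\<close>

text \<open>Lines are numbered from \<open>0\<close> in the order in which the orthogonal wires meet them after the
  cut. The weights \<open>t\<close> of a pair lie on the wire that the orthogonal wires meet first, which
  then has the number \<open>wire_index\<close> and is followed cyclically by the other wire of the pair.\<close>

fun net_grid :: "side \<Rightarrow> nat \<Rightarrow> nat \<Rightarrow> nat \<Rightarrow> nat \<Rightarrow> nat \<times> nat" where
  "net_grid FromLeft n m k l = (Suc k, m - l)"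
| "net_grid FromRight n m k l = (n - k, Suc l)"

fun wire_index :: "side \<Rightarrow> nat \<Rightarrow> nat \<Rightarrow> nat" where
  "wire_index FromLeft n i = i - 1"
| "wire_index FromRight n i = n - cyc_succ n i"

lemma is_grid_net_grid: "is_grid n m n m (net_grid a n m)"
  unfolding is_grid_def
proof (rule bij_betwI')
  fix x y :: "nat \<times> nat" assume "x \<in> {..<n} \<times> {..<m}" "y \<in> {..<n} \<times> {..<m}"
  then show "((case x of (k, l) \<Rightarrow> net_grid a n m k l) = (case y of (k, l) \<Rightarrow> net_grid a n m k l)) = (x = y)"
    by (cases a) auto
next
  fix x :: "nat \<times> nat" assume "x \<in> {..<n} \<times> {..<m}"
  then show "(case x of (k, l) \<Rightarrow> net_grid a n m k l) \<in> {1..n} \<times> {1..m}"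
    by (cases a) auto
next
  fix y :: "nat \<times> nat" assume y: "y \<in> {1..n} \<times> {1..m}"
  show "\<exists>x\<in>{..<n} \<times> {..<m}. y = (case x of (k, l) \<Rightarrow> net_grid a n m k l)"
  proof (cases a)
    case FromLeft
    then show ?thesis using y by (intro bexI[of _ "(fst y - 1, m - snd y)"]) auto
  next
    case FromRight
    then show ?thesis using y by (intro bexI[of _ "(n - fst y, snd y - 1)"]) auto
  qed
qed

lemma wire_index_less: "i \<in> {1..n} \<Longrightarrow> wire_index a n i < n"
  by (cases a) (auto simp: cyc_succ_def)

lemma Suc_wire_index_less: "i \<in> {1..n-1} \<Longrightarrow> Suc (wire_index a n i) < n"
  by (cases a) (auto simp: cyc_succ_def)

lemma hor_pairs_oriented:
  fixes a i n defines "k \<equiv> wire_index a n i"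
  assumes "i \<in> {1..n}"
  shows "hor_pairs a n m i =
     map (\<lambda>r. oriented a (net_grid a n m k r) (net_grid a n m (Suc k mod n) r)) [0..<m]"
  using assms
  by (cases a) (auto simp: hor_pairs_def rev_map[symmetric] rev_nth cyc_succ_def mod_Suc
      simp del: upt_Suc intro!: nth_equalityI)

lemma vert_pairs_oriented:
  fixes a j m defines "l \<equiv> wire_index (opposite a) m j"
  assumes "j \<in> {1..m}"
  shows "vert_pairs a n m j =
     map (\<lambda>r. oriented (opposite a) (net_grid a n m r l) (net_grid a n m r (Suc l mod m))) [0..<n]"
  using assms
  by (cases a) (auto simp: vert_pairs_def rev_map[symmetric] rev_nth cyc_succ_def mod_Suc
      simp del: upt_Suc intro!: nth_equalityI)

lemma hor_op_realizes:
  fixes a i n defines "k \<equiv> wire_index a n i"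
  assumes i: "i \<in> {1..n}" and n: "2 \<le> n"
  shows "realizes n m (hor_e a n m i c) (Act c) m (net_grid a n m k) (net_grid a n m (Suc k mod n))"
    and "realizes n m (hor_s a n m i) Weyl m (net_grid a n m k) (net_grid a n m (Suc k mod n))"
proof -
  note g = is_grid_net_grid[of n m a]
  have k: "k < n" "Suc k mod n < n" "k \<noteq> Suc k mod n"
    using wire_index_less[OF i, of a] n by (auto simp: k_def mod_Suc)
  have inj: "inj_on (net_grid a n m k') {..<m}" if "k' < n" for k'
    using that by (intro inj_onI) (simp add: is_grid_eq_iff[OF g])
  have disj: "net_grid a n m k ` {..<m} \<inter> net_grid a n m (Suc k mod n) ` {..<m} = {}"
    using k by (auto simp: is_grid_eq_iff[OF g])
  note pair = realizes_wire_pair[OF hor_pairs_oriented[where a = a and m = m, OF i, folded k_def]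
      inj[OF k(1)] inj[OF k(2)] disj Un_least[OF is_grid_row_subset[OF g k(1)] is_grid_row_subset[OF g k(2)]]]
  show "realizes n m (hor_e a n m i c) (Act c) m (net_grid a n m k) (net_grid a n m (Suc k mod n))"
    by (rule pair[where f = "\<lambda>_. c"]) (simp_all add: hor_e_def hor_strip_def)
  show "realizes n m (hor_s a n m i) Weyl m (net_grid a n m k) (net_grid a n m (Suc k mod n))"
    by (rule pair[where f = "\<lambda>S. inverse (strip_phi S / strip_eps S)"])
      (simp_all add: hor_s_def hor_gamma_def hor_e_def hor_strip_def)
qed

lemma vert_op_realizes:
  fixes a j m defines "l \<equiv> wire_index (opposite a) m j"
  assumes j: "j \<in> {1..m}" and m: "2 \<le> m"
  shows "realizes n m (vert_e a n m j d) (Act d) n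
      (\<lambda>r. net_grid a n m r l) (\<lambda>r. net_grid a n m r (Suc l mod m))"
    and "realizes n m (vert_s a n m j) Weyl n
      (\<lambda>r. net_grid a n m r l) (\<lambda>r. net_grid a n m r (Suc l mod m))"
proof -
  let ?P = "\<lambda>r. net_grid a n m r l" and ?Q = "\<lambda>r. net_grid a n m r (Suc l mod m)"
  note g = is_grid_transpose[OF is_grid_net_grid[of n m a]]
  have l: "l < m" "Suc l mod m < m" "l \<noteq> Suc l mod m"
    using wire_index_less[OF j, of "opposite a"] m by (auto simp: l_def mod_Suc)
  have inj: "inj_on (\<lambda>r. net_grid a n m r l') {..<n}" if "l' < m" for l'
    using that by (intro inj_onI) (simp add: is_grid_eq_iff[OF g])
  have disj: "?P ` {..<n} \<inter> ?Q ` {..<n} = {}"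
    using l by (auto simp: is_grid_eq_iff[OF g])
  note pair = realizes_wire_pair[OF vert_pairs_oriented[where a = a and n = n, OF j, folded l_def]
      inj[OF l(1)] inj[OF l(2)] disj Un_least[OF is_grid_row_subset[OF g l(1)] is_grid_row_subset[OF g l(2)]]]
  show "realizes n m (vert_e a n m j d) (Act d) n ?P ?Q"
    by (rule pair[where f = "\<lambda>_. d"]) (simp_all add: vert_e_def vert_strip_def)
  show "realizes n m (vert_s a n m j) Weyl n ?P ?Q"
    by (rule pair[where f = "\<lambda>S. inverse (strip_phi S / strip_eps S)"])
      (simp_all add: vert_s_def vert_gamma_def vert_e_def vert_strip_def)
qed

theorem theorem12p3:
  fixes n m :: nat and a :: side
  assumes "n \<ge> 2" and "m \<ge> 2"
  shows "(\<forall>i\<in>{1..n-1}. \<forall>j\<in>{1..m-1}. \<forall>c d. c \<noteq> 0 \<longrightarrow> d \<noteq> 0 \<longrightarrow>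
            rationally_commute n m (hor_e a n m i c) (vert_e a n m j d)) \<and>
         (\<forall>i\<in>{1..n-1}. \<forall>j\<in>{1..m}. \<forall>d. d \<noteq> 0 \<longrightarrow>
            rationally_commute n m (vert_e a n m j d) (hor_s a n m i)) \<and>
         (\<forall>i\<in>{1..n}. \<forall>j\<in>{1..m-1}. \<forall>c. c \<noteq> 0 \<longrightarrow>
            rationally_commute n m (hor_e a n m i c) (vert_s a n m j)) \<and>
         (\<forall>i\<in>{1..n}. \<forall>j\<in>{1..m}.
            rationally_commute n m (hor_s a n m i) (vert_s a n m j))"
proof (intro conjI ballI allI impI)
  note g = is_grid_net_grid[of n m a]
  note g' = is_grid_transpose[OF g]
  let ?k = "wire_index a n" and ?l = "wire_index (opposite a) m"
  have fin: "i \<in> {1..k}" if "i \<in> {1..k-1}" for i k :: nat using that by auto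
  note hor = hor_op_realizes[OF _ assms(1)]
  note vert = vert_op_realizes[OF _ assms(2)]
  {
    fix i j and c d :: complex
    assume i: "i \<in> {1..n-1}" and j: "j \<in> {1..m-1}" and "c \<noteq> 0" "d \<noteq> 0"
    note k = Suc_wire_index_less[OF i, of a] and l = Suc_wire_index_less[OF j, of "opposite a"]
    show "rationally_commute n m (hor_e a n m i c) (vert_e a n m j d)"
      by (rule row_op_column_op_commute[OF g k l hor(1)[where a = a, OF fin[OF i], unfolded mod_less[OF k]] _
            vert(1)[where a = a, OF fin[OF j], unfolded mod_less[OF l]]])
        (simp_all add: \<open>c \<noteq> 0\<close> \<open>d \<noteq> 0\<close>)
  }
  {
    fix i j and d :: complex
    assume i: "i \<in> {1..n-1}" and j: "j \<in> {1..m}" and "d \<noteq> 0"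
    note k = Suc_wire_index_less[OF i, of a]
    show "rationally_commute n m (vert_e a n m j d) (hor_s a n m i)"
      by (rule rationally_commute_sym, rule Weyl_row_commutes_with_cyclic_column_op[OF g k
            wire_index_less[OF j] assms(2) hor(2)[where a = a, OF fin[OF i], unfolded mod_less[OF k]]
            vert(1)[OF j]])
        (simp add: \<open>d \<noteq> 0\<close>)
  }
  {
    fix i j and c :: complex
    assume i: "i \<in> {1..n}" and j: "j \<in> {1..m-1}" and "c \<noteq> 0"
    note l = Suc_wire_index_less[OF j, of "opposite a"]
    show "rationally_commute n m (hor_e a n m i c) (vert_s a n m j)"
      by (rule rationally_commute_sym, rule Weyl_row_commutes_with_cyclic_column_op[OF g' l
            wire_index_less[OF i] assms(1) vert(2)[where a = a, OF fin[OF j], unfolded mod_less[OF l]]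
            hor(1)[OF i]])
        (simp add: \<open>c \<noteq> 0\<close>)
  }
  {
    fix i j
    assume i: "i \<in> {1..n}" and j: "j \<in> {1..m}"
    show "rationally_commute n m (hor_s a n m i) (vert_s a n m j)"
      by (rule cyclic_Weyl_ops_commute[OF g wire_index_less[OF i] wire_index_less[OF j] assms
            hor(2)[OF i] vert(2)[OF j]])
  }
qed

end
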